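(* Let $(M,g)$ be a complete Riemannian manifold or a regular domain, let $o\in M$ be a fixed origin, and let $\alpha\in(0,1)$. Both the Riesz field $R^\alpha$ and the stationary Riesz field $hR^\alpha$ over $(M,g)$ are self-similar of order $\alpha$ (if they exist on $M$) in the following sense: for any $c>0$, if $\bar R^\alpha$ and $h\bar R^\alpha$ are the Riesz field and the stationary Riesz field over $(M,c^2g)$ (with the same origin $o$), then $$c^\alpha R^\alpha_x\stackrel{d}{=}\bar R^\alpha_x\qquad\text{and}\qquad c^\alpha hR^\alpha_x\stackrel{d}{=}h\bar R^\alpha_x .$$
   Context: Conventions: Riemannian manifolds are connected, complete, and of dimension $d$ with $2\le d<\infty$. $\Delta$ is the Laplace–Beltrami operator of the manifold (its unique self-adjoint extension, with spectrum in $(-\infty,0]$), $dV_g$ is the Riemannian measure, and $H_t(x,y)$, $t>0$, is the heat kernel, i.e. the smooth integral kernel of $e^{t\Delta}$ on $L^2(M,dV_g)$. A regular domain is an open, connected, relatively compact subset $D$ of a complete Riemannian manifold such that $\partial D\ne\emptyset$ is smooth; for a regular domain $\Delta$ is the Dirichlet Laplacian and $H_t$ the Dirichlet heat kernel. A Gaussian random field (GRF) over a set $I$ is a family of random variables $\{X_i\}_{i\in I}$ on a complete probability space all of whose finite subfamilies are jointly normal; it is centered if $\mathbb{E}[X_i]=0$ for all $i$. Two centered GRFs over $I$ are equal in (finite-dimensional) distribution, written $\stackrel{d}{=}$, if their covariances $\mathbb{E}[X_sX_t]$ are equal; the notation $X_x\stackrel{d}{=}Y_x$ refers to equality of the fields.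 For a fixed origin $o\in M$ and $\alpha\in(0,1)$, the Riesz field $R^\alpha$ is the centered GRF over $M$ with covariance $$\mathbb{E}[R^\alpha_xR^\alpha_y]=\frac1{\Gamma\left(\frac d2+\alpha\right)}\int_0^\infty t^{\frac d2+\alpha-1}\left(H_t(x,y)-H_t(x,o)-H_t(y,o)+H_t(o,o)\right)dt,$$ and the stationary Riesz field $hR^\alpha$ is the centered GRF over $M$ with covariance $$\mathbb{E}[hR^\alpha_xhR^\alpha_y]=\frac1{\Gamma\left(\frac d2+\alpha\right)}\int_0^\infty t^{\frac d2+\alpha-1}H_t(x,y)\,dt.$$ One says $R^\alpha$ (resp. $hR^\alpha$) exists if the corresponding integral converges to a finite value for all $x,y\in M$. *)

theory Defs
  imports "HOL-Probability.Probability"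
begin

section \<open>Smooth manifolds and Riemannian metrics\<close>

fun Ck_on :: "nat \<Rightarrow> 'e::real_normed_vector set \<Rightarrow> ('e \<Rightarrow> 'f::real_normed_vector) \<Rightarrow> bool" where
  "Ck_on 0 S f \<longleftrightarrow> continuous_on S f"
| "Ck_on (Suc k) S f \<longleftrightarrow>
     (\<forall>x\<in>S. f differentiable (at x)) \<and>
     (\<forall>v. Ck_on k S (\<lambda>x. frechet_derivative f (at x) v))"

text \<open>Only used on open sets.\<close>
definition smooth_on :: "'e::real_normed_vector set \<Rightarrow> ('e \<Rightarrow> 'f::real_normed_vector) \<Rightarrow> bool" where
  "smooth_on S f \<longleftrightarrow> (\<forall>k. Ck_on k S f)"

text \<open>A manifold is the whole type \<open>'a\<close> (Hausdorff, second countable) together with an atlas;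
  its dimension is \<open>CARD('d)\<close>. A chart is a pair of a domain and a map, and the values of the map
  outside the domain are irrelevant.\<close>
type_synonym ('a, 'd) chart = "'a set \<times> ('a \<Rightarrow> real ^ 'd)"

abbreviation chart_dom :: "('a, 'd) chart \<Rightarrow> 'a set" where
  "chart_dom k \<equiv> fst k"

abbreviation chart_map :: "('a, 'd) chart \<Rightarrow> 'a \<Rightarrow> real ^ 'd" where
  "chart_map k \<equiv> snd k"

definition chart_range :: "('a, 'd) chart \<Rightarrow> (real ^ 'd) set" where
  "chart_range k = chart_map k ` chart_dom k"

definition chart_inv :: "('a, 'd) chart \<Rightarrow> real ^ 'd \<Rightarrow> 'a" where
  "chart_inv k = inv_into (chart_dom k) (chart_map k)"

definition transition :: "('a, 'd) chart \<Rightarrow> ('a, 'd) chart \<Rightarrow> real ^ 'd \<Rightarrow> real ^ 'd" where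
  "transition k l = (\<lambda>u. chart_map l (chart_inv k u))"

definition smooth_atlas ::
  "('a::{t2_space,second_countable_topology}, 'd::finite) chart set \<Rightarrow> bool" where
  "smooth_atlas \<A> \<longleftrightarrow>
     (\<Union>k\<in>\<A>. chart_dom k) = UNIV \<and>
     (\<forall>k\<in>\<A>. open (chart_dom k) \<and> open (chart_range k) \<and>
        homeomorphism (chart_dom k) (chart_range k) (chart_map k) (chart_inv k)) \<and>
     (\<forall>k\<in>\<A>. \<forall>l\<in>\<A>.
        smooth_on (chart_map k ` (chart_dom k \<inter> chart_dom l)) (transition k l))"

text \<open>The speed, the gradient norm and the Laplacian computed below in the coordinates of \<open>chart_at \<A> x\<close> do not depend on the
  chart around \<open>x\<close> that is chosen.\<close>
definition chart_at :: "('a, 'd) chart set \<Rightarrow> 'a \<Rightarrow> ('a, 'd) chart" where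
  "chart_at \<A> x = (SOME k. k \<in> \<A> \<and> x \<in> chart_dom k)"

text \<open>A metric tensor is given by its component matrices \<open>(g\<^sub>i\<^sub>j)\<close> in each chart of the atlas.\<close>
type_synonym ('a, 'd) metric_tensor = "('a, 'd) chart \<Rightarrow> 'a \<Rightarrow> real ^ 'd ^ 'd"

definition riemannian_metric ::
  "('a, 'd::finite) chart set \<Rightarrow> ('a, 'd) metric_tensor \<Rightarrow> bool" where
  "riemannian_metric \<A> g \<longleftrightarrow>
     (\<forall>k\<in>\<A>.
        smooth_on (chart_range k) (\<lambda>u. g k (chart_inv k u)) \<and>
        (\<forall>x\<in>chart_dom k. transpose (g k x) = g k x \<and>
           (\<forall>v. v \<noteq> 0 \<longrightarrow> v \<bullet> (g k x *v v) > 0))) \<and>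
     (\<forall>k\<in>\<A>. \<forall>l\<in>\<A>. \<forall>x\<in>chart_dom k \<inter> chart_dom l.
        let J = matrix (frechet_derivative (transition k l) (at (chart_map k x)))
        in g k x = transpose J ** g l x ** J)"

definition riemannian_manifold ::
  "('a::{t2_space,second_countable_topology}, 'd::finite) chart set \<Rightarrow> ('a, 'd) metric_tensor \<Rightarrow> bool"
  where
  "riemannian_manifold \<A> g \<longleftrightarrow>
     smooth_atlas \<A> \<and> connected (UNIV :: 'a set) \<and> riemannian_metric \<A> g"

definition scale_metric :: "real \<Rightarrow> ('a, 'd::finite) metric_tensor \<Rightarrow> ('a, 'd) metric_tensor" where
  "scale_metric s g = (\<lambda>k x. s *\<^sub>R g k x)"


subsection \<open>Riemannian distance and completeness\<close>

definition C1_curve_on ::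
  "('a::topological_space, 'd::finite) chart set \<Rightarrow> real \<Rightarrow> real \<Rightarrow> (real \<Rightarrow> 'a) \<Rightarrow> bool" where
  "C1_curve_on \<A> a b \<gamma> \<longleftrightarrow>
     continuous_on {a..b} \<gamma> \<and>
     (\<forall>k\<in>\<A>. let T = {t \<in> {a..b}. \<gamma> t \<in> chart_dom k} in
        \<exists>v. continuous_on T v \<and>
          (\<forall>t\<in>T. ((\<lambda>s. chart_map k (\<gamma> s)) has_vector_derivative v t) (at t within {a..b})))"

definition piecewise_C1_curve ::
  "('a::topological_space, 'd::finite) chart set \<Rightarrow> (real \<Rightarrow> 'a) \<Rightarrow> bool" where
  "piecewise_C1_curve \<A> \<gamma> \<longleftrightarrow>
     (\<exists>(n::nat) p. p 0 = 0 \<and> p n = 1 \<and>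
        (\<forall>i<n. p i < p (Suc i) \<and> C1_curve_on \<A> (p i) (p (Suc i)) \<gamma>))"

definition speed ::
  "('a, 'd::finite) chart set \<Rightarrow> ('a, 'd) metric_tensor \<Rightarrow> (real \<Rightarrow> 'a) \<Rightarrow> real \<Rightarrow> real" where
  "speed \<A> g \<gamma> t =
     (let k = chart_at \<A> (\<gamma> t);
          v = vector_derivative (\<lambda>s. chart_map k (\<gamma> s)) (at t)
      in sqrt (v \<bullet> (g k (\<gamma> t) *v v)))"

definition curve_length ::
  "('a, 'd::finite) chart set \<Rightarrow> ('a, 'd) metric_tensor \<Rightarrow> (real \<Rightarrow> 'a) \<Rightarrow> real" where
  "curve_length \<A> g \<gamma> = integral {0..1} (speed \<A> g \<gamma>)"

definition riemannian_dist ::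
  "('a::topological_space, 'd::finite) chart set \<Rightarrow> ('a, 'd) metric_tensor \<Rightarrow> 'a \<Rightarrow> 'a \<Rightarrow> real" where
  "riemannian_dist \<A> g x y =
     Inf {curve_length \<A> g \<gamma> |\<gamma>. piecewise_C1_curve \<A> \<gamma> \<and> \<gamma> 0 = x \<and> \<gamma> 1 = y}"

definition complete_riemannian_manifold ::
  "('a::{t2_space,second_countable_topology}, 'd::finite) chart set \<Rightarrow> ('a, 'd) metric_tensor \<Rightarrow> bool"
  where
  "complete_riemannian_manifold \<A> g \<longleftrightarrow>
     riemannian_manifold \<A> g \<and> Metric_space.mcomplete UNIV (riemannian_dist \<A> g)"


subsection \<open>Regular domains\<close>

definition smooth_hypersurface ::
  "('a::topological_space, 'd::finite) chart set \<Rightarrow> 'a set \<Rightarrow> bool" where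
  "smooth_hypersurface \<A> S \<longleftrightarrow>
     (\<forall>p\<in>S. \<exists>k\<in>\<A>. \<exists>W (\<rho> :: real ^ 'd \<Rightarrow> real).
        open W \<and> p \<in> W \<and> W \<subseteq> chart_dom k \<and>
        smooth_on (chart_map k ` W) \<rho> \<and>
        (\<forall>x\<in>W. x \<in> S \<longleftrightarrow> \<rho> (chart_map k x) = 0) \<and>
        frechet_derivative \<rho> (at (chart_map k p)) \<noteq> (\<lambda>v. 0))"

definition regular_domain ::
  "('a::topological_space, 'd::finite) chart set \<Rightarrow> 'a set \<Rightarrow> bool" where
  "regular_domain \<A> D \<longleftrightarrow>
     open D \<and> connected D \<and> compact (closure D) \<and>
     frontier D \<noteq> {} \<and> smooth_hypersurface \<A> (frontier D)"


section \<open>Riemannian measure and Laplace--Beltrami operator\<close>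

definition riemannian_measure ::
  "('a::topological_space, 'd::finite) chart set \<Rightarrow> ('a, 'd) metric_tensor \<Rightarrow> 'a measure \<Rightarrow> bool" where
  "riemannian_measure \<A> g V \<longleftrightarrow>
     sets V = sets borel \<and>
     (\<forall>k\<in>\<A>. \<forall>B\<in>sets borel. B \<subseteq> chart_dom k \<longrightarrow>
        emeasure V B =
          (\<integral>\<^sup>+u\<in>chart_map k ` B. ennreal (sqrt (det (g k (chart_inv k u)))) \<partial>lborel))"

definition partial_deriv :: "'d::finite \<Rightarrow> (real ^ 'd \<Rightarrow> real) \<Rightarrow> real ^ 'd \<Rightarrow> real" where
  "partial_deriv i F u = frechet_derivative F (at u) (axis i 1)"

text \<open>\<open>\<Delta>f = |g|\<^sup>-\<^sup>1\<^sup>/\<^sup>2 \<Sum>\<^sub>i \<partial>\<^sub>i (\<Sum>\<^sub>j |g|\<^sup>1\<^sup>/\<^sup>2 g\<^sup>i\<^sup>j \<partial>\<^sub>j f)\<close> in local coordinates.\<close>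
definition laplace_beltrami ::
  "('a, 'd::finite) chart set \<Rightarrow> ('a, 'd) metric_tensor \<Rightarrow> ('a \<Rightarrow> real) \<Rightarrow> 'a \<Rightarrow> real" where
  "laplace_beltrami \<A> g f x =
     (let k = chart_at \<A> x;
          G = (\<lambda>u. g k (chart_inv k u));
          F = (\<lambda>u. f (chart_inv k u));
          w = (\<lambda>u. sqrt (det (G u)));
          p = chart_map k x
      in (\<Sum>i\<in>UNIV. partial_deriv i
            (\<lambda>u. \<Sum>j\<in>UNIV. w u * matrix_inv (G u) $ i $ j * partial_deriv j F u) p) / w p)"

definition grad_norm_sq ::
  "('a, 'd::finite) chart set \<Rightarrow> ('a, 'd) metric_tensor \<Rightarrow> ('a \<Rightarrow> real) \<Rightarrow> 'a \<Rightarrow> real" where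
  "grad_norm_sq \<A> g f x =
     (let k = chart_at \<A> x;
          F = (\<lambda>u. f (chart_inv k u));
          p = chart_map k x
      in \<Sum>i\<in>UNIV. \<Sum>j\<in>UNIV.
           matrix_inv (g k x) $ i $ j * partial_deriv i F p * partial_deriv j F p)"

text \<open>Test functions on an open set \<open>M\<close>, extended by 0 to the ambient manifold.\<close>
definition test_functions ::
  "('a::topological_space, 'd::finite) chart set \<Rightarrow> 'a set \<Rightarrow> ('a \<Rightarrow> real) set" where
  "test_functions \<A> M =
     {f. (\<forall>k\<in>\<A>. smooth_on (chart_range k) (\<lambda>u. f (chart_inv k u))) \<and>
         (\<exists>K. compact K \<and> K \<subseteq> M \<and> (\<forall>x. x \<notin> K \<longrightarrow> f x = 0))}"


section \<open>Unbounded operators on \<open>L\<^sup>2\<close>\<close>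

text \<open>Elements of \<open>L\<^sup>2(\<mu>)\<close> are represented by functions, and operators by graphs; equality of
  elements is equality almost everywhere. The real Hilbert space suffices, as the Laplacian and
  its heat semigroup are real operators.\<close>
definition L2 :: "'a measure \<Rightarrow> ('a \<Rightarrow> real) set" where
  "L2 \<mu> = {f. f \<in> borel_measurable \<mu> \<and> integrable \<mu> (\<lambda>x. (f x)\<^sup>2)}"

definition l2_inner :: "'a measure \<Rightarrow> ('a \<Rightarrow> real) \<Rightarrow> ('a \<Rightarrow> real) \<Rightarrow> real" where
  "l2_inner \<mu> f h = (\<integral>x. f x * h x \<partial>\<mu>)"

definition l2_norm :: "'a measure \<Rightarrow> ('a \<Rightarrow> real) \<Rightarrow> real" where
  "l2_norm \<mu> f = sqrt (\<integral>x. (f x)\<^sup>2 \<partial>\<mu>)"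

type_synonym 'a operator_graph = "(('a \<Rightarrow> real) \<times> ('a \<Rightarrow> real)) set"

definition densely_defined :: "'a measure \<Rightarrow> 'a operator_graph \<Rightarrow> bool" where
  "densely_defined \<mu> A \<longleftrightarrow>
     (\<forall>f\<in>L2 \<mu>. \<forall>e>0. \<exists>(u, h)\<in>A. l2_norm \<mu> (\<lambda>x. f x - u x) < e)"

definition adjoint_graph :: "'a measure \<Rightarrow> 'a operator_graph \<Rightarrow> 'a operator_graph" where
  "adjoint_graph \<mu> A =
     {(u, f). u \<in> L2 \<mu> \<and> f \<in> L2 \<mu> \<and> (\<forall>(v, h)\<in>A. l2_inner \<mu> h u = l2_inner \<mu> v f)}"

text \<open>Linearity and single-valuedness almost everywhere of \<open>A\<close> are automatic here: the adjoint graph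
  is linear, and it is single-valued because \<open>A\<close> is densely defined.\<close>
definition self_adjoint_op :: "'a measure \<Rightarrow> 'a operator_graph \<Rightarrow> bool" where
  "self_adjoint_op \<mu> A \<longleftrightarrow>
     A \<subseteq> L2 \<mu> \<times> L2 \<mu> \<and> densely_defined \<mu> A \<and> A = adjoint_graph \<mu> A"

text \<open>\<open>P t = e\<^sup>t\<^sup>A\<close> for a self-adjoint operator \<open>A\<close>: the strongly continuous contraction semigroup
  whose generator is \<open>A\<close>. That it consists of contractions is the same as the spectrum of \<open>A\<close>
  being contained in \<open>(-\<infinity>, 0]\<close>.\<close>
definition heat_semigroup ::
  "'a measure \<Rightarrow> 'a operator_graph \<Rightarrow> (real \<Rightarrow> ('a \<Rightarrow> real) \<Rightarrow> ('a \<Rightarrow> real)) \<Rightarrow> bool" where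
  "heat_semigroup \<mu> A P \<longleftrightarrow>
     self_adjoint_op \<mu> A \<and>
     (\<forall>t\<ge>0. \<forall>f\<in>L2 \<mu>. P t f \<in> L2 \<mu> \<and> l2_norm \<mu> (P t f) \<le> l2_norm \<mu> f) \<and>
     (\<forall>t\<ge>0. \<forall>f\<in>L2 \<mu>. \<forall>h\<in>L2 \<mu>. \<forall>a b.
        AE x in \<mu>. P t (\<lambda>y. a * f y + b * h y) x = a * P t f x + b * P t h x) \<and>
     (\<forall>f\<in>L2 \<mu>. AE x in \<mu>. P 0 f x = f x) \<and>
     (\<forall>s\<ge>0. \<forall>t\<ge>0. \<forall>f\<in>L2 \<mu>. AE x in \<mu>. P (s + t) f x = P s (P t f) x) \<and>
     (\<forall>f\<in>L2 \<mu>. ((\<lambda>t. l2_norm \<mu> (\<lambda>x. P t f x - f x)) \<longlongrightarrow> 0) (at_right 0)) \<and>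
     A = {(f, h). f \<in> L2 \<mu> \<and> h \<in> L2 \<mu> \<and>
            ((\<lambda>t. l2_norm \<mu> (\<lambda>x. (P t f x - f x) / t - h x)) \<longlongrightarrow> 0) (at_right 0)}"


section \<open>The Laplacian and the heat kernel\<close>

text \<open>Below, \<open>M\<close> is either \<open>UNIV\<close>, i.e. the whole complete manifold, or a regular domain in it.\<close>
definition minimal_laplacian ::
  "('a::topological_space, 'd::finite) chart set \<Rightarrow> ('a, 'd) metric_tensor \<Rightarrow> 'a set \<Rightarrow>
   'a operator_graph" where
  "minimal_laplacian \<A> g M = {(f, laplace_beltrami \<A> g f) |f. f \<in> test_functions \<A> M}"

text \<open>The closure of the test functions in the Sobolev space \<open>W\<^sup>1\<^sup>,\<^sup>2(M)\<close>.\<close>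
definition sobolev_H01 ::
  "('a::topological_space, 'd::finite) chart set \<Rightarrow> ('a, 'd) metric_tensor \<Rightarrow> 'a measure \<Rightarrow> 'a set \<Rightarrow>
   ('a \<Rightarrow> real) set" where
  "sobolev_H01 \<A> g \<mu> M =
     {u \<in> L2 \<mu>. \<exists>\<phi> :: nat \<Rightarrow> 'a \<Rightarrow> real.
        (\<forall>n. \<phi> n \<in> test_functions \<A> M) \<and>
        (\<lambda>n. l2_norm \<mu> (\<lambda>x. \<phi> n x - u x)) \<longlonglongrightarrow> 0 \<and>
        (\<forall>e>0. \<exists>N. \<forall>m\<ge>N. \<forall>n\<ge>N. (\<integral>x. grad_norm_sq \<A> g (\<lambda>y. \<phi> m y - \<phi> n y) x \<partial>\<mu>) < e)}"

text \<open>The distributional Laplacian restricted to \<open>{u \<in> H\<^sup>1\<^sub>0(M). \<Delta>u \<in> L\<^sup>2(M)}\<close>.\<close>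
definition dirichlet_laplacian ::
  "('a::topological_space, 'd::finite) chart set \<Rightarrow> ('a, 'd) metric_tensor \<Rightarrow> 'a measure \<Rightarrow> 'a set \<Rightarrow>
   'a operator_graph" where
  "dirichlet_laplacian \<A> g \<mu> M =
     {(u, f). u \<in> sobolev_H01 \<A> g \<mu> M \<and> f \<in> L2 \<mu> \<and>
        (\<forall>\<phi>\<in>test_functions \<A> M. l2_inner \<mu> f \<phi> = l2_inner \<mu> u (laplace_beltrami \<A> g \<phi>))}"

definition laplacian ::
  "('a::topological_space, 'd::finite) chart set \<Rightarrow> ('a, 'd) metric_tensor \<Rightarrow> 'a measure \<Rightarrow> 'a set \<Rightarrow>
   'a operator_graph \<Rightarrow> bool" where
  "laplacian \<A> g \<mu> M A \<longleftrightarrow>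
     (if M = UNIV
      then {B. self_adjoint_op \<mu> B \<and> minimal_laplacian \<A> g M \<subseteq> B} = {A}
      else A = dirichlet_laplacian \<A> g \<mu> M)"

definition smooth_kernel ::
  "('a::topological_space, 'd::finite) chart set \<Rightarrow> 'a set \<Rightarrow> ('a \<Rightarrow> 'a \<Rightarrow> real) \<Rightarrow> bool" where
  "smooth_kernel \<A> M h \<longleftrightarrow>
     (\<forall>k\<in>\<A>. \<forall>l\<in>\<A>.
        smooth_on (chart_map k ` (chart_dom k \<inter> M) \<times> chart_map l ` (chart_dom l \<inter> M))
          (\<lambda>(u, v). h (chart_inv k u) (chart_inv l v)))"

definition integral_kernel ::
  "'a measure \<Rightarrow> ('a \<Rightarrow> 'a \<Rightarrow> real) \<Rightarrow> (('a \<Rightarrow> real) \<Rightarrow> ('a \<Rightarrow> real)) \<Rightarrow> bool" where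
  "integral_kernel \<mu> h T \<longleftrightarrow>
     (\<forall>f\<in>L2 \<mu>. AE x in \<mu>. integrable \<mu> (\<lambda>y. h x y * f y) \<and> T f x = (\<integral>y. h x y * f y \<partial>\<mu>))"

text \<open>The measure \<open>V\<close> and the operator \<open>A\<close> are determined by \<open>(M, g)\<close>, the semigroup \<open>P\<close> is
  determined up to null sets, and \<open>H t x y\<close> is determined for \<open>t > 0\<close> and \<open>x, y \<in> M\<close>.\<close>
definition heat_kernel ::
  "('a::topological_space, 'd::finite) chart set \<Rightarrow> ('a, 'd) metric_tensor \<Rightarrow> 'a set \<Rightarrow>
   (real \<Rightarrow> 'a \<Rightarrow> 'a \<Rightarrow> real) \<Rightarrow> bool" where
  "heat_kernel \<A> g M H \<longleftrightarrow>
     (\<exists>V A P. riemannian_measure \<A> g V \<and>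
        laplacian \<A> g (restrict_space V M) M A \<and>
        heat_semigroup (restrict_space V M) A P \<and>
        (\<forall>t>0. smooth_kernel \<A> M (H t) \<and> integral_kernel (restrict_space V M) (H t) (P t)))"


section \<open>Gaussian random fields\<close>

text \<open>Degenerate normal distributions are included.\<close>
definition normal_rv :: "'w measure \<Rightarrow> ('w \<Rightarrow> real) \<Rightarrow> bool" where
  "normal_rv \<Omega> Y \<longleftrightarrow>
     Y \<in> borel_measurable \<Omega> \<and>
     ((\<exists>m. AE \<omega> in \<Omega>. Y \<omega> = m) \<or>
      (\<exists>m \<sigma>. \<sigma> > 0 \<and> distributed \<Omega> lborel Y (\<lambda>x. ennreal (normal_density m \<sigma> x))))"

definition jointly_normal :: "'w measure \<Rightarrow> 'i set \<Rightarrow> ('i \<Rightarrow> 'w \<Rightarrow> real) \<Rightarrow> bool" where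
  "jointly_normal \<Omega> F X \<longleftrightarrow> (\<forall>a :: 'i \<Rightarrow> real. normal_rv \<Omega> (\<lambda>\<omega>. \<Sum>i\<in>F. a i * X i \<omega>))"

definition gaussian_field :: "'w measure \<Rightarrow> 'i set \<Rightarrow> ('i \<Rightarrow> 'w \<Rightarrow> real) \<Rightarrow> bool" where
  "gaussian_field \<Omega> I X \<longleftrightarrow>
     prob_space \<Omega> \<and> complete_measure \<Omega> \<and>
     (\<forall>F. finite F \<and> F \<subseteq> I \<longrightarrow> jointly_normal \<Omega> F X)"

definition centered_gaussian_field :: "'w measure \<Rightarrow> 'i set \<Rightarrow> ('i \<Rightarrow> 'w \<Rightarrow> real) \<Rightarrow> bool" where
  "centered_gaussian_field \<Omega> I X \<longleftrightarrow>
     gaussian_field \<Omega> I X \<and> (\<forall>i\<in>I. prob_space.expectation \<Omega> (X i) = 0)"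

text \<open>The two fields may live on different probability spaces.\<close>
definition equal_in_distribution ::
  "'i set \<Rightarrow> 'w measure \<Rightarrow> ('i \<Rightarrow> 'w \<Rightarrow> real) \<Rightarrow> 'v measure \<Rightarrow> ('i \<Rightarrow> 'v \<Rightarrow> real) \<Rightarrow> bool" where
  "equal_in_distribution I \<Omega> X \<Omega>' Y \<longleftrightarrow>
     centered_gaussian_field \<Omega> I X \<and> centered_gaussian_field \<Omega>' I Y \<and>
     (\<forall>s\<in>I. \<forall>t\<in>I. prob_space.expectation \<Omega> (\<lambda>\<omega>. X s \<omega> * X t \<omega>) =
                    prob_space.expectation \<Omega>' (\<lambda>\<omega>. Y s \<omega> * Y t \<omega>))"


section \<open>Riesz fields\<close>

definition riesz_integrand ::
  "nat \<Rightarrow> real \<Rightarrow> 'a \<Rightarrow> (real \<Rightarrow> 'a \<Rightarrow> 'a \<Rightarrow> real) \<Rightarrow> 'a \<Rightarrow> 'a \<Rightarrow> real \<Rightarrow> real" where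
  "riesz_integrand d \<alpha> p H x y t =
     t powr (real d / 2 + \<alpha> - 1) * (H t x y - H t x p - H t y p + H t p p)"

definition stationary_riesz_integrand ::
  "nat \<Rightarrow> real \<Rightarrow> (real \<Rightarrow> 'a \<Rightarrow> 'a \<Rightarrow> real) \<Rightarrow> 'a \<Rightarrow> 'a \<Rightarrow> real \<Rightarrow> real" where
  "stationary_riesz_integrand d \<alpha> H x y t = t powr (real d / 2 + \<alpha> - 1) * H t x y"

text \<open>Convergence of the integrals is absolute convergence. This is no restriction: the stationary
  integrand is nonnegative, and the other one is positive semidefinite in \<open>(x, y)\<close>, hence dominated
  by its nonnegative diagonal values, which are integrable as well.\<close>
definition riesz_field_exists ::
  "('a::topological_space, 'd::finite) chart set \<Rightarrow> ('a, 'd) metric_tensor \<Rightarrow> 'a set \<Rightarrow> 'a \<Rightarrow> real \<Rightarrow>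
   bool" where
  "riesz_field_exists \<A> g M p \<alpha> \<longleftrightarrow>
     (\<exists>H. heat_kernel \<A> g M H \<and>
        (\<forall>x\<in>M. \<forall>y\<in>M. set_integrable lborel {0<..} (riesz_integrand CARD('d) \<alpha> p H x y)))"

definition stationary_riesz_field_exists ::
  "('a::topological_space, 'd::finite) chart set \<Rightarrow> ('a, 'd) metric_tensor \<Rightarrow> 'a set \<Rightarrow> real \<Rightarrow> bool"
  where
  "stationary_riesz_field_exists \<A> g M \<alpha> \<longleftrightarrow>
     (\<exists>H. heat_kernel \<A> g M H \<and>
        (\<forall>x\<in>M. \<forall>y\<in>M. set_integrable lborel {0<..} (stationary_riesz_integrand CARD('d) \<alpha> H x y)))"

definition riesz_field ::
  "('a::topological_space, 'd::finite) chart set \<Rightarrow> ('a, 'd) metric_tensor \<Rightarrow> 'a set \<Rightarrow> 'a \<Rightarrow> real \<Rightarrow>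
   'w measure \<Rightarrow> ('a \<Rightarrow> 'w \<Rightarrow> real) \<Rightarrow> bool" where
  "riesz_field \<A> g M p \<alpha> \<Omega> R \<longleftrightarrow>
     centered_gaussian_field \<Omega> M R \<and>
     (\<exists>H. heat_kernel \<A> g M H \<and>
        (\<forall>x\<in>M. \<forall>y\<in>M.
           set_integrable lborel {0<..} (riesz_integrand CARD('d) \<alpha> p H x y) \<and>
           prob_space.expectation \<Omega> (\<lambda>\<omega>. R x \<omega> * R y \<omega>) =
             1 / Gamma (real CARD('d) / 2 + \<alpha>) *
             set_lebesgue_integral lborel {0<..} (riesz_integrand CARD('d) \<alpha> p H x y)))"

definition stationary_riesz_field ::
  "('a::topological_space, 'd::finite) chart set \<Rightarrow> ('a, 'd) metric_tensor \<Rightarrow> 'a set \<Rightarrow> real \<Rightarrow>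
   'w measure \<Rightarrow> ('a \<Rightarrow> 'w \<Rightarrow> real) \<Rightarrow> bool" where
  "stationary_riesz_field \<A> g M \<alpha> \<Omega> R \<longleftrightarrow>
     centered_gaussian_field \<Omega> M R \<and>
     (\<exists>H. heat_kernel \<A> g M H \<and>
        (\<forall>x\<in>M. \<forall>y\<in>M.
           set_integrable lborel {0<..} (stationary_riesz_integrand CARD('d) \<alpha> H x y) \<and>
           prob_space.expectation \<Omega> (\<lambda>\<omega>. R x \<omega> * R y \<omega>) =
             1 / Gamma (real CARD('d) / 2 + \<alpha>) *
             set_lebesgue_integral lborel {0<..} (stationary_riesz_integrand CARD('d) \<alpha> H x y)))"

end

(* The heat kernel of c^2 g is c^(-d) H (t / c^2): the Laplacian is divided by c^2 and the volume is
   multiplied by c^d, so the heat semigroup runs slower by the factor c^2 while its kernel is taken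
   against a larger measure. Substituting t = c^2 s in the covariance integrals produces the factor
   c^(2 \<alpha>).

   Since the given fields may come with any heat kernel, uniqueness is needed as well: a contraction
   semigroup is determined by its generator, because s \<mapsto> P (t - s) (Q s f) is constant when P and Q
   have the same generator, and a continuous kernel is determined by its integral operator. *)
theory Submission
  imports Defs
begin

section \<open>Smooth functions\<close>

text \<open>Equality in \<open>L2 \<mu>\<close> is equality almost everywhere and the semigroup laws
  hold only in that sense, so "constant" for the curve that compares P and Q can only mean that its
  distance to P t f is zero. That distance is a real function of s, and it is controlled by a growth
  estimate from the right only, because the generator is a limit from the right. No derivative of
  the outer factor P (t - s) is taken: it is a contraction and drops out of the estimates.

  The two kinds of \<open>M\<close> need different arguments for the operator. On the whole manifold
  it is characterised as the only self-adjoint extension of the minimal Laplacian, and division by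
  c^2 is a bijection between the extensions for the two metrics. On a regular domain it is an
  explicit graph, and the Sobolev space in its definition is the same for both metrics.

  A kernel is tied to its operator only for almost every point, whereas the covariances evaluate it
  at given points. Continuity of the kernels and the positive measure of open sets bridge this
  gap.\<close>

text \<open>The equation is assumed on \<open>S\<close> only, because the induction can compare the
  derivatives of \<open>h\<close> and \<open>f\<close> only at points of \<open>S\<close>. Openness
  of \<open>S\<close> makes this enough to determine the derivative of \<open>h\<close>
  there.\<close>

lemma Ck_on_cmult:
  fixes f h :: "'e::real_normed_vector \<Rightarrow> 'f::real_normed_vector"
  assumes "open S" "Ck_on n S f" "\<And>x. x \<in> S \<Longrightarrow> h x = c *\<^sub>R f x"
  shows "Ck_on n S h"
  using assms(2,3)
proof (induction n arbitrary: f h)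
  case 0
  then show ?case
    by (auto intro!: continuous_intros cong: continuous_on_cong)
next
  case (Suc n)
  have D: "(h has_derivative (\<lambda>v. c *\<^sub>R frechet_derivative f (at x) v)) (at x)" if "x \<in> S" for x
  proof -
    have "(f has_derivative frechet_derivative f (at x)) (at x)"
      using Suc.prems(1) that by (auto simp: frechet_derivative_works)
    then have "((\<lambda>x. c *\<^sub>R f x) has_derivative (\<lambda>v. c *\<^sub>R frechet_derivative f (at x) v)) (at x)"
      by (rule has_derivative_scaleR_right)
    then show ?thesis
      by (rule has_derivative_transform_within_open[OF _ \<open>open S\<close> that]) (simp add: Suc.prems(2))
  qed
  have "Ck_on n S (\<lambda>x. frechet_derivative h (at x) v)" for v
  proof (rule Suc.IH)
    show "Ck_on n S (\<lambda>x. frechet_derivative f (at x) v)"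
      using Suc.prems(1) by simp
    show "frechet_derivative h (at x) v = c *\<^sub>R frechet_derivative f (at x) v" if "x \<in> S" for x
      using frechet_derivative_at[OF D[OF that]] by metis
  qed
  with D show ?case
    by (auto simp: differentiable_def)
qed

lemma smooth_on_cmult:
  assumes "open S" "smooth_on S f" "\<And>x. x \<in> S \<Longrightarrow> h x = c *\<^sub>R f x"
  shows "smooth_on S h"
  using assms Ck_on_cmult unfolding smooth_on_def by blast

lemma smooth_on_imp_continuous_on: "smooth_on S f \<Longrightarrow> continuous_on S f"
  unfolding smooth_on_def by (metis Ck_on.simps(1))

lemma smooth_on_imp_differentiable: "smooth_on S f \<Longrightarrow> x \<in> S \<Longrightarrow> f differentiable (at x)"
  unfolding smooth_on_def by (metis Ck_on.simps(2))

lemma smooth_on_frechet_derivative: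
  "smooth_on S f \<Longrightarrow> smooth_on S (\<lambda>x. frechet_derivative f (at x) v)"
  unfolding smooth_on_def by (metis Ck_on.simps(2))

lemma frechet_derivative_cmult:
  fixes f :: "'e::real_normed_vector \<Rightarrow> real"
  assumes "f differentiable (at x)"
  shows "frechet_derivative (\<lambda>y. c * f y) (at x) = (\<lambda>v. c * frechet_derivative f (at x) v)"
proof -
  have "(f has_derivative frechet_derivative f (at x)) (at x)"
    using assms by (simp add: frechet_derivative_works)
  then have "((\<lambda>y. c * f y) has_derivative (\<lambda>v. c * frechet_derivative f (at x) v)) (at x)"
    by (rule has_derivative_mult_right)
  then show ?thesis
    by (rule frechet_derivative_at[symmetric])
qed

section \<open>Matrices\<close>

lemma det_scaleR: "det (r *\<^sub>R A) = r ^ CARD('n) * det (A :: real ^ 'n ^ 'n)"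
  using det_rows_mul[of "\<lambda>_. r" "\<lambda>i. A $ i"]
  by (simp add: scalar_mult_eq_scaleR scaleR_vec_def)

text \<open>A right inverse of a square matrix is two-sided, so the choice behind
  \<open>matrix_inv\<close> has a witness, and associativity identifies the chosen matrix with
  \<open>B\<close>.\<close>

lemma matrix_inv_eqI:
  fixes A B :: "real ^ 'n ^ 'n"
  assumes "A ** B = mat 1"
  shows "matrix_inv A = B"
proof -
  have "\<exists>C. A ** C = mat 1 \<and> C ** A = mat 1"
    using assms matrix_left_right_inverse by blast
  then have "matrix_inv A ** A = mat 1"
    unfolding matrix_inv_def by (rule someI2_ex) blast
  then have "B = matrix_inv A ** (A ** B)"
    by (simp add: matrix_mul_assoc)
  then show ?thesis using assms by simp
qed

lemma matrix_inv_right: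
  fixes A :: "real ^ 'n ^ 'n"
  assumes "det A \<noteq> 0"
  shows "A ** matrix_inv A = mat 1"
  by (metis assms invertible_det_nz invertible_def matrix_inv_eqI)

lemma matrix_inv_scaleR:
  fixes A :: "real ^ 'n ^ 'n"
  assumes "det A \<noteq> 0" "r \<noteq> 0"
  shows "matrix_inv (r *\<^sub>R A) = (1 / r) *\<^sub>R matrix_inv A"
proof (rule matrix_inv_eqI)
  show "r *\<^sub>R A ** ((1 / r) *\<^sub>R matrix_inv A) = mat 1"
    using assms matrix_inv_right[OF assms(1)]
    by (simp add: matrix_scalar_ac flip: scalar_matrix_assoc)
qed

text \<open>Column \<open>j\<close> of the inverse solves the linear system with right-hand side
  \<open>axis j 1\<close>. Cramer's rule turns its entries into quotients of polynomials in the
  entries of \<open>A\<close>, which is how the inverse metric is seen to be differentiable.\<close>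

lemma matrix_inv_nth_cramer:
  fixes A :: "real ^ 'n ^ 'n"
  assumes "det A \<noteq> 0"
  shows "matrix_inv A $ i $ j = det (\<chi> k l. if l = i then axis j 1 $ k else A $ k $ l) / det A"
proof -
  have "A *v (matrix_inv A *v axis j 1) = axis j 1"
    by (simp add: matrix_vector_mul_assoc matrix_inv_right[OF assms])
  then have "matrix_inv A *v axis j 1 =
      (\<chi> i. det (\<chi> k l. if l = i then axis j 1 $ k else A $ k $ l) / det A)"
    using cramer[OF assms] by blast
  moreover have "(matrix_inv A *v axis j 1) $ i = matrix_inv A $ i $ j"
    by (simp add: matrix_vector_mult_basis column_def)
  ultimately show ?thesis by simp
qed

text \<open>The segment from the identity matrix to \<open>A\<close> consists of positive definite, hence
  nonsingular matrices, so \<open>det\<close> has no sign change on it.\<close>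
lemma det_positive_definite:
  fixes A :: "real ^ 'n ^ 'n"
  assumes "\<And>v. v \<noteq> 0 \<Longrightarrow> v \<bullet> (A *v v) > 0"
  shows "det A > 0"
proof (rule ccontr)
  define B where "B s = (1 - s) *\<^sub>R mat 1 + s *\<^sub>R A" for s :: real
  assume "\<not> det A > 0"
  moreover have "continuous_on {0..1} (\<lambda>s. det (B s))"
    unfolding B_def det_def by (intro continuous_intros)
  ultimately have "\<exists>s\<ge>0. s \<le> 1 \<and> det (B s) = 0"
    by (intro IVT2') (auto simp: B_def)
  then obtain s where s: "0 \<le> s" "s \<le> 1" "det (B s) = 0" by blast
  then have "\<not> invertible (B s)" by (simp add: invertible_det_nz)
  then obtain v where v: "B s *v v = 0" "v \<noteq> 0"
    by (metis invertible_left_inverse matrix_left_invertible_ker)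
  have "0 = v \<bullet> (B s *v v)" using v by simp
  also have "\<dots> = (1 - s) * (v \<bullet> v) + s * (v \<bullet> (A *v v))"
    by (simp add: B_def matrix_vector_mult_add_rdistrib inner_add_right flip: scaleR_matrix_vector_assoc)
  also have "\<dots> > 0"
    using s assms[OF v(2)] v(2)
    by (cases "s = 0") (auto intro!: add_nonneg_pos mult_nonneg_nonneg)
  finally show False by simp
qed

lemma differentiable_prod:
  fixes f :: "'i \<Rightarrow> 'a::real_normed_vector \<Rightarrow> real"
  assumes "\<And>i. i \<in> I \<Longrightarrow> f i differentiable (at x within S)"
  shows "(\<lambda>x. \<Prod>i\<in>I. f i x) differentiable (at x within S)"
  using assms
  by (induction I rule: infinite_finite_induct) (auto intro: differentiable_mult)

lemma differentiable_det:
  fixes A :: "'a::real_normed_vector \<Rightarrow> real ^ 'n ^ 'n"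
  assumes "\<And>i j. (\<lambda>x. A x $ i $ j) differentiable (at x within S)"
  shows "(\<lambda>x. det (A x)) differentiable (at x within S)"
  unfolding det_def
  by (auto intro!: differentiable_sum differentiable_mult differentiable_prod assms finite_permutations)

lemma differentiable_matrix_inv_nth:
  fixes A :: "'a::real_normed_vector \<Rightarrow> real ^ 'n ^ 'n"
  assumes A: "\<And>i j. (\<lambda>x. A x $ i $ j) differentiable (at x)"
    and "open S" "x \<in> S" and nz: "\<And>y. y \<in> S \<Longrightarrow> det (A y) \<noteq> 0"
  shows "(\<lambda>y. matrix_inv (A y) $ i $ j) differentiable (at x)"
proof -
  have "(\<lambda>y. (if l = i then axis j 1 $ k else A y $ k $ l)) differentiable (at x)" for k l
    using A by (cases "l = i") auto
  then have "(\<lambda>y. det (\<chi> k l. if l = i then axis j 1 $ k else A y $ k $ l) / det (A y))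
      differentiable (at x)"
    using nz \<open>x \<in> S\<close> A by (intro differentiable_divide differentiable_det) auto
  then obtain D where "((\<lambda>y. det (\<chi> k l. if l = i then axis j 1 $ k else A y $ k $ l) / det (A y))
      has_derivative D) (at x)"
    by (auto simp: differentiable_def)
  then have "((\<lambda>y. matrix_inv (A y) $ i $ j) has_derivative D) (at x)"
    by (rule has_derivative_transform_within_open[OF _ \<open>open S\<close> \<open>x \<in> S\<close>])
      (simp add: matrix_inv_nth_cramer nz)
  then show ?thesis by (auto simp: differentiable_def)
qed

section \<open>Contraction semigroups on \<open>L\<^sup>2\<close>\<close>

lemma L2_lincomb:
  assumes "f \<in> L2 \<mu>" "h \<in> L2 \<mu>"
  shows "(\<lambda>x. a * f x + b * h x) \<in> L2 \<mu>"
proof -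
  have [measurable]: "f \<in> borel_measurable \<mu>" "h \<in> borel_measurable \<mu>"
    using assms by (auto simp: L2_def)
  \<comment> \<open>A bound by squares avoids the mixed product of \<open>f\<close> and
    \<open>h\<close>. It exceeds the square of the sum by the square of
    \<open>a * f x - b * h x\<close>.\<close>
  have "integrable \<mu> (\<lambda>x. 2 * (a\<^sup>2 * (f x)\<^sup>2) + 2 * (b\<^sup>2 * (h x)\<^sup>2))"
    using assms by (auto simp: L2_def)
  then have "integrable \<mu> (\<lambda>x. (a * f x + b * h x)\<^sup>2)"
  proof (rule Bochner_Integration.integrable_bound)
    have "(a * f x + b * h x)\<^sup>2 \<le> 2 * (a\<^sup>2 * (f x)\<^sup>2) + 2 * (b\<^sup>2 * (h x)\<^sup>2)" for x
      using zero_le_power2[of "a * f x - b * h x"] by (simp add: power2_eq_square algebra_simps)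
    then show "AE x in \<mu>. norm ((a * f x + b * h x)\<^sup>2)
        \<le> norm (2 * (a\<^sup>2 * (f x)\<^sup>2) + 2 * (b\<^sup>2 * (h x)\<^sup>2))"
      by (intro AE_I2) (simp add: abs_of_nonneg)
  qed measurable
  then show ?thesis by (simp add: L2_def)
qed

lemma L2_diff: "f \<in> L2 \<mu> \<Longrightarrow> h \<in> L2 \<mu> \<Longrightarrow> (\<lambda>x. f x - h x) \<in> L2 \<mu>"
  using L2_lincomb[of f \<mu> h 1 "-1"] by simp

lemma L2_cmult: "f \<in> L2 \<mu> \<Longrightarrow> (\<lambda>x. c * f x) \<in> L2 \<mu>"
  using L2_lincomb[of f \<mu> f c 0] by simp

lemma l2_norm_nonneg: "0 \<le> l2_norm \<mu> f"
  by (simp add: l2_norm_def)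

lemma l2_norm_power2: "(l2_norm \<mu> f)\<^sup>2 = (\<integral>x. (f x)\<^sup>2 \<partial>\<mu>)"
  by (simp add: l2_norm_def)

lemma l2_norm_cmult: "l2_norm \<mu> (\<lambda>x. c * f x) = \<bar>c\<bar> * l2_norm \<mu> f"
  by (simp add: l2_norm_def power_mult_distrib real_sqrt_mult)

lemma l2_norm_cong_AE:
  assumes "f \<in> L2 \<mu>" "h \<in> L2 \<mu>" "AE x in \<mu>. f x = h x"
  shows "l2_norm \<mu> f = l2_norm \<mu> h"
proof -
  have "(\<integral>x. (f x)\<^sup>2 \<partial>\<mu>) = (\<integral>x. (h x)\<^sup>2 \<partial>\<mu>)"
    using assms by (intro integral_cong_AE) (auto simp: L2_def)
  then show ?thesis by (simp add: l2_norm_def)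
qed

lemma l2_norm_eq_0_AE:
  assumes "f \<in> L2 \<mu>" "l2_norm \<mu> f = 0"
  shows "AE x in \<mu>. f x = 0"
  using assms integral_nonneg_eq_0_iff_AE[of \<mu> "\<lambda>x. (f x)\<^sup>2"]
  by (auto simp: L2_def l2_norm_def)

lemma l2_norm_triangle:
  assumes "f \<in> L2 \<mu>" "h \<in> L2 \<mu>"
  shows "l2_norm \<mu> (\<lambda>x. f x + h x) \<le> l2_norm \<mu> f + l2_norm \<mu> h"
proof -
  let ?a = "l2_norm \<mu> f" and ?b = "l2_norm \<mu> h"
  have fh: "(\<lambda>x. f x + h x) \<in> L2 \<mu>"
    using L2_lincomb[OF assms, of 1 1] by simp
  \<comment> \<open>Weighted AM-GM; the optimal weights are the norms themselves.\<close>
  have bound: "(l2_norm \<mu> (\<lambda>x. f x + h x))\<^sup>2 \<le> (a + b) * (?a\<^sup>2 / a + ?b\<^sup>2 / b)"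
    if "a > 0" "b > 0" for a b
  proof -
    have pw: "(f x + h x)\<^sup>2 \<le> (a + b) * ((f x)\<^sup>2 / a + (h x)\<^sup>2 / b)" for x
    proof -
      have "(a + b) * ((f x)\<^sup>2 / a + (h x)\<^sup>2 / b) - (f x + h x)\<^sup>2 = (b * f x - a * h x)\<^sup>2 / (a * b)"
        using that by (simp add: field_simps power2_eq_square)
      also have "\<dots> \<ge> 0" using that by simp
      finally show ?thesis by simp
    qed
    have "(l2_norm \<mu> (\<lambda>x. f x + h x))\<^sup>2 = (\<integral>x. (f x + h x)\<^sup>2 \<partial>\<mu>)"
      by (simp add: l2_norm_power2)
    also have "\<dots> \<le> (\<integral>x. (a + b) * ((f x)\<^sup>2 / a + (h x)\<^sup>2 / b) \<partial>\<mu>)"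
      using fh assms pw by (intro integral_mono) (auto simp: L2_def)
    also have "\<dots> = (a + b) * (?a\<^sup>2 / a + ?b\<^sup>2 / b)"
      using assms by (simp add: L2_def l2_norm_power2)
    finally show ?thesis .
  qed
  \<comment> \<open>A norm may vanish and then is not admissible as a weight, so \<open>e\<close> is
    added to both norms and removed at the end.\<close>
  have le: "l2_norm \<mu> (\<lambda>x. f x + h x) \<le> ?a + ?b + 2 * e" if "e > 0" for e
  proof (rule power2_le_imp_le)
    let ?a' = "?a + e" and ?b' = "?b + e"
    have pos: "?a' > 0" "?b' > 0" using that by (auto intro: add_nonneg_pos l2_norm_nonneg)
    have sq: "?a\<^sup>2 / ?a' \<le> ?a'" "?b\<^sup>2 / ?b' \<le> ?b'"
      using pos that l2_norm_nonneg[of \<mu>]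
      by (auto simp: divide_le_eq power2_eq_square intro!: mult_mono)
    have "(l2_norm \<mu> (\<lambda>x. f x + h x))\<^sup>2 \<le> (?a' + ?b') * (?a\<^sup>2 / ?a' + ?b\<^sup>2 / ?b')"
      by (rule bound) (use pos in auto)
    also have "\<dots> \<le> (?a' + ?b') * (?a' + ?b')"
      using sq pos by (intro mult_left_mono) auto
    finally show "(l2_norm \<mu> (\<lambda>x. f x + h x))\<^sup>2 \<le> (?a + ?b + 2 * e)\<^sup>2"
      by (simp add: power2_eq_square algebra_simps)
    show "0 \<le> ?a + ?b + 2 * e"
      using pos by simp
  qed
  show ?thesis
  proof (rule field_le_epsilon)
    fix e :: real assume "e > 0"
    then show "l2_norm \<mu> (\<lambda>x. f x + h x) \<le> ?a + ?b + e"
      using le[of "e / 2"] by simp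
  qed
qed

text \<open>A pseudometric on \<open>L2 \<mu>\<close> that vanishes exactly for functions equal
  almost everywhere. It turns the semigroup laws into statements about real numbers, which combine
  by the triangle inequality.\<close>

definition l2_dist :: "'a measure \<Rightarrow> ('a \<Rightarrow> real) \<Rightarrow> ('a \<Rightarrow> real) \<Rightarrow> real" where
  "l2_dist \<mu> f h = l2_norm \<mu> (\<lambda>x. f x - h x)"

lemma l2_dist_nonneg: "0 \<le> l2_dist \<mu> f h"
  by (simp add: l2_dist_def l2_norm_nonneg)

lemma l2_dist_sym: "l2_dist \<mu> f h = l2_dist \<mu> h f"
  by (simp add: l2_dist_def l2_norm_def power2_commute)

lemma l2_dist_triangle:
  assumes "f \<in> L2 \<mu>" "h \<in> L2 \<mu>" "k \<in> L2 \<mu>"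
  shows "l2_dist \<mu> f k \<le> l2_dist \<mu> f h + l2_dist \<mu> h k"
  using l2_norm_triangle[OF L2_diff[OF assms(1,2)] L2_diff[OF assms(2,3)]]
  by (simp add: l2_dist_def)

lemma l2_dist_AE:
  assumes "f \<in> L2 \<mu>" "h \<in> L2 \<mu>" "AE x in \<mu>. f x = h x"
  shows "l2_dist \<mu> f h = 0"
proof -
  have "l2_dist \<mu> f h = l2_norm \<mu> (\<lambda>x. 0 * f x)"
    unfolding l2_dist_def using assms
    by (intro l2_norm_cong_AE L2_diff L2_cmult) auto
  then show ?thesis using l2_norm_cmult[of \<mu> 0 f] by simp
qed

lemma l2_dist_eq_0_AE:
  assumes "f \<in> L2 \<mu>" "h \<in> L2 \<mu>" "l2_dist \<mu> f h = 0"
  shows "AE x in \<mu>. f x = h x"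
  using l2_norm_eq_0_AE[OF L2_diff[OF assms(1,2)]] assms(3) by (simp add: l2_dist_def)

section \<open>Consequences of the semigroup axioms\<close>

context
  fixes \<mu> A P
  assumes P: "heat_semigroup \<mu> A P"
begin

lemma semigroup_L2: "t \<ge> 0 \<Longrightarrow> f \<in> L2 \<mu> \<Longrightarrow> P t f \<in> L2 \<mu>"
  using P by (simp add: heat_semigroup_def)

lemma semigroup_norm_le: "t \<ge> 0 \<Longrightarrow> f \<in> L2 \<mu> \<Longrightarrow> l2_norm \<mu> (P t f) \<le> l2_norm \<mu> f"
  using P by (simp add: heat_semigroup_def)

lemma semigroup_linear:
  "t \<ge> 0 \<Longrightarrow> f \<in> L2 \<mu> \<Longrightarrow> h \<in> L2 \<mu> \<Longrightarrow>
    AE x in \<mu>. P t (\<lambda>y. a * f y + b * h y) x = a * P t f x + b * P t h x"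
  using P by (simp add: heat_semigroup_def)

lemma semigroup_dist_le:
  assumes "t \<ge> 0" "f \<in> L2 \<mu>" "h \<in> L2 \<mu>"
  shows "l2_dist \<mu> (P t f) (P t h) \<le> l2_dist \<mu> f h"
proof -
  have "l2_dist \<mu> (P t f) (P t h) = l2_norm \<mu> (P t (\<lambda>y. f y - h y))"
    unfolding l2_dist_def
    using semigroup_linear[OF assms, of 1 "-1"] assms
    by (intro l2_norm_cong_AE L2_diff semigroup_L2) auto
  also have "\<dots> \<le> l2_dist \<mu> f h"
    unfolding l2_dist_def using assms by (intro semigroup_norm_le L2_diff)
  finally show ?thesis .
qed

lemma semigroup_0_dist: "f \<in> L2 \<mu> \<Longrightarrow> l2_dist \<mu> (P 0 f) f = 0"
  using P by (intro l2_dist_AE) (auto simp: heat_semigroup_def)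

lemma semigroup_add_dist:
  "s \<ge> 0 \<Longrightarrow> t \<ge> 0 \<Longrightarrow> f \<in> L2 \<mu> \<Longrightarrow> l2_dist \<mu> (P (s + t) f) (P s (P t f)) = 0"
  using P by (intro l2_dist_AE semigroup_L2) (auto simp: heat_semigroup_def)

lemma semigroup_continuous: "f \<in> L2 \<mu> \<Longrightarrow> ((\<lambda>t. l2_dist \<mu> (P t f) f) \<longlongrightarrow> 0) (at_right 0)"
  using P by (simp add: heat_semigroup_def l2_dist_def)

lemma generator_iff:
  "(f, h) \<in> A \<longleftrightarrow> f \<in> L2 \<mu> \<and> h \<in> L2 \<mu> \<and>
    ((\<lambda>t. l2_norm \<mu> (\<lambda>x. (P t f x - f x) / t - h x)) \<longlongrightarrow> 0) (at_right 0)"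
proof -
  have "A = {(f, h). f \<in> L2 \<mu> \<and> h \<in> L2 \<mu> \<and>
            ((\<lambda>t. l2_norm \<mu> (\<lambda>x. (P t f x - f x) / t - h x)) \<longlongrightarrow> 0) (at_right 0)}"
    using P by (simp only: heat_semigroup_def)
  then show ?thesis by blast
qed

lemma generator_quotient_L2:
  assumes "(f, h) \<in> A" "t \<ge> 0"
  shows "(\<lambda>x. (P t f x - f x) / t - h x) \<in> L2 \<mu>"
  using assms L2_diff[OF L2_cmult[OF L2_diff[OF semigroup_L2[of t f]], of f "1/t"], of h]
  by (auto simp: generator_iff)

text \<open>\<open>P s\<close> commutes with \<open>P t\<close> and is linear, so the difference
  quotient of \<open>P s f\<close> minus \<open>P s h\<close> is the image under \<open>P s\<close>
  of the difference quotient of \<open>f\<close> minus \<open>h\<close>. The contraction property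
  then transfers the limit.\<close>

lemma semigroup_generator_invariant:
  assumes "(f, h) \<in> A" "s \<ge> 0"
  shows "(P s f, P s h) \<in> A"
proof -
  have f: "f \<in> L2 \<mu>" and h: "h \<in> L2 \<mu>"
    and lim: "((\<lambda>t. l2_norm \<mu> (\<lambda>x. (P t f x - f x) / t - h x)) \<longlongrightarrow> 0) (at_right 0)"
    using assms(1) by (auto simp: generator_iff)
  have "l2_norm \<mu> (\<lambda>x. (P t (P s f) x - P s f x) / t - P s h x)
      \<le> l2_norm \<mu> (\<lambda>x. (P t f x - f x) / t - h x)" if t: "t > 0" for t
  proof -
    note L = semigroup_L2 L2_diff f h
    \<comment> \<open>The coefficients \<open>1\<close> and \<open>-1\<close> give the difference
      the shape of the linearity axiom.\<close>
    let ?q = "\<lambda>x. 1 * P t f x + (-1) * f x"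
    have q: "?q \<in> L2 \<mu>" using t by (intro L2_lincomb L) auto
    have "AE x in \<mu>. P (t + s) f x = P t (P s f) x" "AE x in \<mu>. P (s + t) f x = P s (P t f) x"
      using P f t assms(2) by (auto simp: heat_semigroup_def)
    moreover have "AE x in \<mu>. P s ?q x = 1 * P s (P t f) x + (-1) * P s f x"
      using t assms(2) by (intro semigroup_linear L) auto
    moreover have "AE x in \<mu>. P s (\<lambda>y. (1 / t) * ?q y + (-1) * h y) x
        = (1 / t) * P s ?q x + (-1) * P s h x"
      using assms(2) q by (intro semigroup_linear h)
    ultimately have eq: "AE x in \<mu>. (1 / t) * (P t (P s f) x - P s f x) - P s h x =
        P s (\<lambda>y. (1 / t) * ?q y + (-1) * h y) x"
      by eventually_elim (simp add: add.commute)
    have "l2_norm \<mu> (\<lambda>x. (1 / t) * (P t (P s f) x - P s f x) - P s h x) =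
        l2_norm \<mu> (P s (\<lambda>y. (1 / t) * ?q y + (-1) * h y))"
      using t assms(2) q by (intro l2_norm_cong_AE[OF _ _ eq] L L2_cmult L2_lincomb) auto
    also have "\<dots> \<le> l2_norm \<mu> (\<lambda>y. (1 / t) * ?q y + (-1) * h y)"
      by (rule semigroup_norm_le[OF assms(2) L2_lincomb[OF q h]])
    finally show ?thesis by simp
  qed
  then have "((\<lambda>t. l2_norm \<mu> (\<lambda>x. (P t (P s f) x - P s f x) / t - P s h x)) \<longlongrightarrow> 0) (at_right 0)"
    by (intro tendsto_sandwich[OF _ _ tendsto_const lim])
      (auto simp: l2_norm_nonneg intro: eventually_mono[OF eventually_at_right_less])
  then show ?thesis
    using f h assms(2) by (simp add: generator_iff semigroup_L2)
qed

end

section \<open>Uniqueness of the semigroup with a given generator\<close>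

text \<open>Both difference quotients of \<open>f\<close> tend to the same \<open>h\<close>, so they
  tend to each other, and \<open>f\<close> cancels in their difference.\<close>

lemma common_generator_tangent:
  assumes P: "heat_semigroup \<mu> A P" and Q: "heat_semigroup \<mu> A Q" and A: "(f, h) \<in> A"
  shows "((\<lambda>t. l2_dist \<mu> (P t f) (Q t f) / t) \<longlongrightarrow> 0) (at_right 0)"
proof -
  let ?p = "\<lambda>t x. (P t f x - f x) / t - h x" and ?q = "\<lambda>t x. (Q t f x - f x) / t - h x"
  have lim: "((\<lambda>t. l2_norm \<mu> (?p t) + l2_norm \<mu> (?q t)) \<longlongrightarrow> 0 + 0) (at_right 0)"
    using A generator_iff[OF P] generator_iff[OF Q] by (intro tendsto_add) auto
  have "l2_dist \<mu> (P t f) (Q t f) / t \<le> l2_norm \<mu> (?p t) + l2_norm \<mu> (?q t)" if t: "t > 0" for t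
  proof -
    have "l2_dist \<mu> (P t f) (Q t f) / t = l2_norm \<mu> (\<lambda>x. (1 / t) * (P t f x - Q t f x))"
      using t by (simp only: l2_norm_cmult l2_dist_def) simp
    also have "(\<lambda>x. (1 / t) * (P t f x - Q t f x)) = (\<lambda>x. ?p t x + (-1) * ?q t x)"
      by (simp add: fun_eq_iff diff_divide_distrib)
    also have "l2_norm \<mu> \<dots> \<le> l2_norm \<mu> (?p t) + l2_norm \<mu> (\<lambda>x. (-1) * ?q t x)"
      using t A by (intro l2_norm_triangle L2_cmult generator_quotient_L2[OF P] generator_quotient_L2[OF Q]) auto
    finally show ?thesis by (simp only: l2_norm_cmult)
  qed
  then have "\<forall>\<^sub>F t in at_right 0. l2_dist \<mu> (P t f) (Q t f) / t \<le> l2_norm \<mu> (?p t) + l2_norm \<mu> (?q t)"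
    by (rule eventually_mono[OF eventually_at_right_less])
  moreover have "\<forall>\<^sub>F t in at_right 0. 0 \<le> l2_dist \<mu> (P t f) (Q t f) / t"
    by (rule eventually_mono[OF eventually_at_right_less[of 0]]) (simp add: l2_dist_nonneg)
  ultimately show ?thesis
    using lim tendsto_sandwich[OF _ _ tendsto_const] by fastforce
qed

text \<open>A continuity argument along [0, t]: for every slope \<open>e\<close> the bound \<phi> r
  \<le> e * r cannot stop holding before \<open>t\<close>. The assumption \<open>right\<close>
  carries it beyond a point, and \<open>left\<close>, a weak form of semicontinuity from the left,
  carries it to the supremum of the points reached.\<close>

lemma nonpos_of_right_dini_derivative:
  fixes \<phi> :: "real \<Rightarrow> real"
  assumes "t \<ge> 0" "\<phi> 0 \<le> 0"
    and right: "\<And>s e. 0 \<le> s \<Longrightarrow> s < t \<Longrightarrow> e > 0 \<Longrightarrow> \<forall>\<^sub>F h in at_right 0. \<phi> (s + h) \<le> \<phi> s + e * h"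
    and left: "\<And>s. 0 < s \<Longrightarrow> s \<le> t \<Longrightarrow>
      \<exists>\<omega>. (\<omega> \<longlongrightarrow> 0) (at_right 0) \<and> (\<forall>h. 0 < h \<and> h \<le> s \<longrightarrow> \<phi> s \<le> \<phi> (s - h) + \<omega> h)"
  shows "\<phi> t \<le> 0"
proof -
  have "\<phi> t \<le> e * t" if e: "e > 0" for e
  proof -
    \<comment> \<open>The bound is required on the whole of [0, s], so that it holds at every point
      below the supremum.\<close>
    define S where "S = {s. 0 \<le> s \<and> s \<le> t \<and> (\<forall>r. 0 \<le> r \<and> r \<le> s \<longrightarrow> \<phi> r \<le> e * r)}"
    define \<sigma> where "\<sigma> = Sup S"
    have S0: "0 \<in> S" using assms(1,2) by (auto simp: S_def)
    have bdd: "bdd_above S" by (auto simp: S_def bdd_above_def)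
    have \<sigma>: "0 \<le> \<sigma>" "\<sigma> \<le> t"
      using S0 bdd unfolding \<sigma>_def by (auto intro!: cSup_upper cSup_least simp: S_def)
    have below: "\<phi> r \<le> e * r" if "0 \<le> r" "r < \<sigma>" for r
    proof -
      obtain s where "s \<in> S" "r < s"
        using \<open>r < \<sigma>\<close> S0 bdd unfolding \<sigma>_def by (subst (asm) less_cSup_iff) auto
      then show ?thesis using \<open>0 \<le> r\<close> by (auto simp: S_def)
    qed
    \<comment> \<open>Just below \<open>\<sigma>\<close> the bound is known; the error term
      \<open>\<omega> h\<close> vanishes in the limit.\<close>
    have at: "\<phi> \<sigma> \<le> e * \<sigma>"
    proof (cases "\<sigma> = 0")
      case True
      then show ?thesis using assms(2) by simp
    next
      case False
      with \<sigma> have "\<sigma> > 0" by simp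
      from left[OF this \<sigma>(2)] obtain \<omega> where \<omega>: "(\<omega> \<longlongrightarrow> 0) (at_right 0)"
        and le: "\<And>h. 0 < h \<Longrightarrow> h \<le> \<sigma> \<Longrightarrow> \<phi> \<sigma> \<le> \<phi> (\<sigma> - h) + \<omega> h" by blast
      have "((\<lambda>h. e * \<sigma> + \<omega> h) \<longlongrightarrow> e * \<sigma> + 0) (at_right 0)"
        by (intro tendsto_intros \<omega>)
      moreover have "\<forall>\<^sub>F h in at_right 0. h \<in> {0<..<\<sigma>}"
        using \<open>\<sigma> > 0\<close> eventually_at_right_real by blast
      then have "\<forall>\<^sub>F h in at_right 0. \<phi> \<sigma> \<le> e * \<sigma> + \<omega> h"
      proof eventually_elim
        case (elim h)
        then have "\<phi> \<sigma> \<le> e * (\<sigma> - h) + \<omega> h"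
          using le[of h] below[of "\<sigma> - h"] by auto
        moreover have "0 < e * h" using e elim by simp
        ultimately show ?case by (simp add: right_diff_distrib)
      qed
      ultimately show ?thesis
        using tendsto_lowerbound[of "\<lambda>h. e * \<sigma> + \<omega> h" "e * \<sigma> + 0" "at_right 0" "\<phi> \<sigma>"] by simp
    qed
    have "\<sigma> = t"
    proof (rule ccontr)
      assume "\<sigma> \<noteq> t"
      with \<sigma> have "\<sigma> < t" by simp
      from right[OF \<sigma>(1) this e] obtain b where b: "b > 0"
        and ub: "\<And>h. 0 < h \<Longrightarrow> h < b \<Longrightarrow> \<phi> (\<sigma> + h) \<le> \<phi> \<sigma> + e * h"
        by (auto simp: eventually_at_right_field)
      \<comment> \<open>Half of \<open>b\<close> keeps \<open>h\<close> strictly inside the range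
        where the growth estimate holds, and \<open>t - \<sigma>\<close> prevents an overshoot
        beyond \<open>t\<close>.\<close>
      define h where "h = min (b / 2) (t - \<sigma>)"
      have h: "0 < h" "h < b" "\<sigma> + h \<le> t" using b \<open>\<sigma> < t\<close> by (auto simp: h_def)
      have "\<phi> r \<le> e * r" if r: "0 \<le> r" "r \<le> \<sigma> + h" for r
      proof -
        consider "r < \<sigma>" | "r = \<sigma>" | "r > \<sigma>" by linarith
        then show ?thesis
        proof cases
          case 3
          then have "\<phi> r \<le> \<phi> \<sigma> + e * (r - \<sigma>)" using ub[of "r - \<sigma>"] r h by simp
          then show ?thesis using at by (simp add: right_diff_distrib)
        qed (use below at r in auto)
      qed
      then have "\<sigma> + h \<in> S" using h \<sigma> by (simp add: S_def)
      then have "\<sigma> + h \<le> \<sigma>" unfolding \<sigma>_def using bdd by (rule cSup_upper)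
      then show False using h by simp
    qed
    then show ?thesis using at by simp
  qed
  moreover have "\<forall>\<^sub>F e in at_right 0. (0::real) < e" by (rule eventually_at_right_less)
  ultimately have "\<forall>\<^sub>F e in at_right 0. \<phi> t \<le> e * t" by (auto elim: eventually_mono)
  moreover have "((\<lambda>e. e * t) \<longlongrightarrow> 0 * t) (at_right 0)" by (intro tendsto_intros)
  ultimately show ?thesis
    using tendsto_lowerbound[of "\<lambda>e. e * t" "0 * t" "at_right 0" "\<phi> t"] by simp
qed

text \<open>For \<open>f\<close> in the domain of the generator, \<open>s \<mapsto> P (t - s) (Q s f)\<close> has right derivative zero.\<close>
lemma semigroup_unique_on_domain:
  assumes P: "heat_semigroup \<mu> A P" and Q: "heat_semigroup \<mu> A Q" and A: "(f, g) \<in> A" and t: "t \<ge> 0"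
  shows "l2_dist \<mu> (P t f) (Q t f) = 0"
proof -
  have f: "f \<in> L2 \<mu>" using A generator_iff[OF P] by auto
  \<comment> \<open>At s = 0 this is zero because \<open>Q 0\<close> is the identity, and at s = t
    it is the distance of \<open>Q t f\<close> and \<open>P t f\<close>, because \<open>P 0\<close>
    is the identity.\<close>
  define \<phi> where "\<phi> s = l2_dist \<mu> (P (t - s) (Q s f)) (P t f)" for s
  have in_L2: "Q s f \<in> L2 \<mu>" "P (t - s) (Q s f) \<in> L2 \<mu>" "P t f \<in> L2 \<mu>"
    "P h (Q s f) \<in> L2 \<mu>" "Q h (Q s f) \<in> L2 \<mu>" "Q h f \<in> L2 \<mu>"
    if "0 \<le> s" "s \<le> t" "0 \<le> h" for s h
    using that t f by (auto intro!: semigroup_L2[OF P] semigroup_L2[OF Q])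
  \<comment> \<open>\<open>P (t - s)\<close> is \<open>P (t - (s + h))\<close> after
    \<open>P h\<close>. The common contraction drops out, and what is left is the disagreement of
    the two semigroups over a time \<open>h\<close>.\<close>
  have step: "l2_dist \<mu> (P (t - s) (Q s f)) (P (t - (s + h)) (Q (s + h) f))
      \<le> l2_dist \<mu> (P h (Q s f)) (Q (s + h) f)" if "0 \<le> s" "0 \<le> h" "s + h \<le> t" for s h
  proof -
    let ?u = "P (t - (s + h)) (P h (Q s f))"
    have u: "?u \<in> L2 \<mu>" using in_L2 that by (auto intro!: semigroup_L2[OF P])
    have "l2_dist \<mu> (P (t - s) (Q s f)) ?u = 0"
      using semigroup_add_dist[OF P, of "t - (s + h)" h "Q s f"] in_L2 that by simp
    moreover have "l2_dist \<mu> ?u (P (t - (s + h)) (Q (s + h) f)) \<le> l2_dist \<mu> (P h (Q s f)) (Q (s + h) f)"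
      using in_L2 that by (intro semigroup_dist_le[OF P]) auto
    ultimately show ?thesis
      using l2_dist_triangle[of "P (t - s) (Q s f)" \<mu> ?u "P (t - (s + h)) (Q (s + h) f)"] u in_L2 that
      by auto
  qed
  have Qadd: "l2_dist \<mu> (P h (Q s f)) (Q (s + h) f) = l2_dist \<mu> (P h (Q s f)) (Q h (Q s f))"
    if "0 \<le> s" "0 \<le> h" "s + h \<le> t" for s h
  proof -
    have z: "l2_dist \<mu> (Q (s + h) f) (Q h (Q s f)) = 0"
      using semigroup_add_dist[OF Q, of h s f] f that by (simp add: add.commute)
    have L: "P h (Q s f) \<in> L2 \<mu>" "Q (s + h) f \<in> L2 \<mu>" "Q h (Q s f) \<in> L2 \<mu>"
      using in_L2 that by auto
    from l2_dist_triangle[OF L(1,2,3)] l2_dist_triangle[OF L(1,3,2)] z show ?thesis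
      by (simp add: l2_dist_sym[of \<mu> "Q h (Q s f)"])
  qed
  have "\<phi> t \<le> 0"
  proof (rule nonpos_of_right_dini_derivative[OF t])
    show "\<phi> 0 \<le> 0"
      using semigroup_dist_le[OF P t, of "Q 0 f" f] semigroup_0_dist[OF Q f] f in_L2[of 0 0] t
      by (simp add: \<phi>_def)
  next
    fix s e :: real assume s: "0 \<le> s" "s < t" and e: "e > 0"
    \<comment> \<open>The point \<open>Q s f\<close> is again in the domain, so over a time
      \<open>h\<close> both semigroups move it in the same way up to o(h).\<close>
    have "(Q s f, Q s g) \<in> A" using semigroup_generator_invariant[OF Q A s(1)] .
    from common_generator_tangent[OF P Q this]
    have "\<forall>\<^sub>F h in at_right 0. l2_dist \<mu> (P h (Q s f)) (Q h (Q s f)) / h < e"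
      using e by (rule order_tendstoD)
    moreover have "\<forall>\<^sub>F h in at_right 0. h \<in> {0<..<t - s}"
      using s by (intro eventually_at_right_real) simp
    ultimately show "\<forall>\<^sub>F h in at_right 0. \<phi> (s + h) \<le> \<phi> s + e * h"
    proof eventually_elim
      case (elim h)
      then have "l2_dist \<mu> (P h (Q s f)) (Q h (Q s f)) \<le> e * h"
        by (simp add: field_simps)
      then have "l2_dist \<mu> (P (t - (s + h)) (Q (s + h) f)) (P (t - s) (Q s f)) \<le> e * h"
        using step[of s h] Qadd[of s h] s elim
        by (subst l2_dist_sym) auto
      then show ?case
        using l2_dist_triangle[of "P (t - (s + h)) (Q (s + h) f)" \<mu> "P (t - s) (Q s f)" "P t f"] in_L2 s elim
        by (auto simp: \<phi>_def)
    qed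
  next
    fix s assume s: "0 < s" "s \<le> t"
    \<comment> \<open>The axioms give continuity at time zero only. The first term is the effect of
      \<open>P h\<close> on \<open>Q s f\<close>; the second one bounds the distance of
      \<open>Q (s - h) f\<close> and \<open>Q s f\<close>, since \<open>Q (s - h)\<close> is a
      contraction.\<close>
    define \<omega> where "\<omega> h = l2_dist \<mu> (P h (Q s f)) (Q s f) + l2_dist \<mu> (Q h f) f" for h
    have "(\<omega> \<longlongrightarrow> 0 + 0) (at_right 0)"
      unfolding \<omega>_def using s in_L2(1)[of s 0] f
      by (intro tendsto_add semigroup_continuous[OF P] semigroup_continuous[OF Q]) auto
    moreover have "\<phi> s \<le> \<phi> (s - h) + \<omega> h" if h: "0 < h" "h \<le> s" for h
    proof -
      have L: "P h (Q (s - h) f) \<in> L2 \<mu>" "Q s f \<in> L2 \<mu>" "P h (Q s f) \<in> L2 \<mu>" "Q (s - h) f \<in> L2 \<mu>"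
        "Q (s - h) (Q h f) \<in> L2 \<mu>"
        using in_L2 h s f by (auto intro!: semigroup_L2[OF Q])
      have "l2_dist \<mu> (Q (s - h) f) (Q s f) \<le> l2_dist \<mu> f (Q h f)"
        using l2_dist_triangle[OF L(4,5,2)] semigroup_add_dist[OF Q, of "s - h" h f]
          semigroup_dist_le[OF Q, of "s - h" f "Q h f"] h s f in_L2[of s h]
        by (simp add: l2_dist_sym[of \<mu> "Q (s - h) (Q h f)"])
      moreover have "l2_dist \<mu> (P h (Q (s - h) f)) (P h (Q s f)) \<le> l2_dist \<mu> (Q (s - h) f) (Q s f)"
        using h L by (intro semigroup_dist_le[OF P]) auto
      ultimately have "l2_dist \<mu> (P h (Q (s - h) f)) (Q s f) \<le> \<omega> h"
        using l2_dist_triangle[OF L(1,3,2)] by (simp add: \<omega>_def l2_dist_sym[of \<mu> f])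
      then have "l2_dist \<mu> (P (t - s) (Q s f)) (P (t - (s - h)) (Q (s - h) f)) \<le> \<omega> h"
        using step[of "s - h" h] h s
        by (subst l2_dist_sym) auto
      then show ?thesis
        using l2_dist_triangle[of "P (t - s) (Q s f)" \<mu> "P (t - (s - h)) (Q (s - h) f)" "P t f"]
          in_L2[of s h] in_L2[of "s - h" h] h s
        by (auto simp: \<phi>_def)
    qed
    ultimately show "\<exists>\<omega>. (\<omega> \<longlongrightarrow> 0) (at_right 0) \<and> (\<forall>h. 0 < h \<and> h \<le> s \<longrightarrow> \<phi> s \<le> \<phi> (s - h) + \<omega> h)"
      by (intro exI[of _ \<omega>] conjI allI impI) simp_all
  qed
  then have "l2_dist \<mu> (P 0 (Q t f)) (P t f) = 0"
    using l2_dist_nonneg[of \<mu> "P 0 (Q t f)" "P t f"] by (simp add: \<phi>_def)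
  moreover have "l2_dist \<mu> (P 0 (Q t f)) (Q t f) = 0"
    using t f by (intro semigroup_0_dist[OF P] semigroup_L2[OF Q])
  ultimately show ?thesis
    using l2_dist_triangle[of "P t f" \<mu> "P 0 (Q t f)" "Q t f"] l2_dist_nonneg[of \<mu> "P t f" "Q t f"]
      in_L2[of t 0] t
    by (simp add: l2_dist_sym[of \<mu> "P t f" "P 0 (Q t f)"])
qed

text \<open>The domain is dense and both operators are contractions: replacing \<open>f\<close> by a
  point of the domain within \<open>e / 2\<close> costs at most \<open>e / 2\<close> on each
  side.\<close>

lemma semigroup_unique:
  assumes P: "heat_semigroup \<mu> A P" and Q: "heat_semigroup \<mu> A Q" and f: "f \<in> L2 \<mu>" and t: "t \<ge> 0"
  shows "AE x in \<mu>. P t f x = Q t f x"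
proof (rule l2_dist_eq_0_AE)
  show L: "P t f \<in> L2 \<mu>" "Q t f \<in> L2 \<mu>"
    using t f by (auto intro: semigroup_L2[OF P] semigroup_L2[OF Q])
  have "l2_dist \<mu> (P t f) (Q t f) \<le> e" if "e > 0" for e
  proof -
    have "densely_defined \<mu> A"
      using P unfolding heat_semigroup_def self_adjoint_op_def by blast
    then have "\<forall>e>0. \<exists>(u, h)\<in>A. l2_norm \<mu> (\<lambda>x. f x - u x) < e"
      using f by (simp add: densely_defined_def)
    from this[rule_format, of "e / 2"] have "\<exists>(u, h)\<in>A. l2_norm \<mu> (\<lambda>x. f x - u x) < e / 2"
      using that by simp
    then obtain u h where u: "(u, h) \<in> A" "l2_dist \<mu> f u < e / 2"
      by (auto simp: l2_dist_def)
    then have uL: "u \<in> L2 \<mu>" using generator_iff[OF P] by auto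
    have L': "P t u \<in> L2 \<mu>" "Q t u \<in> L2 \<mu>"
      using t uL by (auto intro: semigroup_L2[OF P] semigroup_L2[OF Q])
    show ?thesis
      using l2_dist_triangle[OF L(1) L'(1) L(2)] l2_dist_triangle[OF L' L(2)]
        semigroup_dist_le[OF P t f uL] semigroup_dist_le[OF Q t f uL]
        semigroup_unique_on_domain[OF P Q u(1) t] u(2)
      by (simp add: l2_dist_sym[of \<mu> "Q t u"])
  qed
  then show "l2_dist \<mu> (P t f) (Q t f) = 0"
    using l2_dist_nonneg[of \<mu> "P t f" "Q t f"] field_le_epsilon[of "l2_dist \<mu> (P t f) (Q t f)" 0] by simp
qed

section \<open>Geometry in charts\<close>

lemma smooth_atlasD:
  assumes "smooth_atlas \<A>" "k \<in> \<A>"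
  shows "open (chart_dom k)" "open (chart_range k)"
    and "homeomorphism (chart_dom k) (chart_range k) (chart_map k) (chart_inv k)"
  using assms by (auto simp: smooth_atlas_def)

lemma chart_at_in:
  assumes "smooth_atlas \<A>"
  shows "chart_at \<A> x \<in> \<A>" "x \<in> chart_dom (chart_at \<A> x)"
proof -
  have "\<exists>k. k \<in> \<A> \<and> x \<in> chart_dom k"
    using assms unfolding smooth_atlas_def by blast
  then have "chart_at \<A> x \<in> \<A> \<and> x \<in> chart_dom (chart_at \<A> x)"
    unfolding chart_at_def by (rule someI_ex)
  then show "chart_at \<A> x \<in> \<A>" "x \<in> chart_dom (chart_at \<A> x)" by auto
qed

lemma chart_simps:
  assumes "smooth_atlas \<A>" "k \<in> \<A>"
  shows "x \<in> chart_dom k \<Longrightarrow> chart_inv k (chart_map k x) = x"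
    and "u \<in> chart_range k \<Longrightarrow> chart_map k (chart_inv k u) = u"
    and "x \<in> chart_dom k \<Longrightarrow> chart_map k x \<in> chart_range k"
    and "u \<in> chart_range k \<Longrightarrow> chart_inv k u \<in> chart_dom k"
  using smooth_atlasD(3)[OF assms] unfolding homeomorphism_def by auto

text \<open>As a preimage under the continuous map \<open>chart_inv k\<close>, the image of an open
  or Borel set is open or Borel.\<close>

lemma chart_image_eq:
  assumes "smooth_atlas \<A>" "k \<in> \<A>" "B \<subseteq> chart_dom k"
  shows "chart_map k ` B = chart_range k \<inter> chart_inv k -` B"
proof (intro equalityI subsetI)
  fix u assume "u \<in> chart_range k \<inter> chart_inv k -` B"
  then show "u \<in> chart_map k ` B"
    using chart_simps(2)[OF assms(1,2), of u] by (metis IntD1 IntD2 image_eqI vimageD)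
next
  fix u assume "u \<in> chart_map k ` B"
  then show "u \<in> chart_range k \<inter> chart_inv k -` B"
    using chart_simps(1,3)[OF assms(1,2)] assms(3) by auto
qed

lemma open_chart_image:
  assumes "smooth_atlas \<A>" "k \<in> \<A>" "open B" "B \<subseteq> chart_dom k"
  shows "open (chart_map k ` B)"
  using assms continuous_open_preimage homeomorphism_cont2 smooth_atlasD
  by (metis chart_image_eq)

lemma borel_chart_image:
  assumes "smooth_atlas \<A>" "k \<in> \<A>" "B \<in> sets borel" "B \<subseteq> chart_dom k"
  shows "chart_map k ` B \<in> sets borel"
proof -
  have "chart_inv k \<in> borel_measurable (restrict_space borel (chart_range k))"
    using assms smooth_atlasD(3) homeomorphism_cont2
    by (intro borel_measurable_continuous_on_restrict) blast
  then have "chart_inv k -` B \<inter> space (restrict_space borel (chart_range k))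
      \<in> sets (restrict_space borel (chart_range k))"
    using assms(3) by (rule measurable_sets)
  then have "chart_inv k -` B \<inter> chart_range k \<in> sets borel"
    using smooth_atlasD(2)[OF assms(1,2)] by (simp add: space_restrict_space sets_restrict_space_iff)
  then show ?thesis
    using chart_image_eq[OF assms(1,2,4)] by (simp add: Int_commute)
qed

section \<open>Local expressions under a rescaling of the metric\<close>

context
  fixes \<A> :: "('a::{t2_space,second_countable_topology}, 'd::finite) chart set"
    and g :: "('a, 'd) metric_tensor"
  assumes \<A>: "smooth_atlas \<A>" and g: "riemannian_metric \<A> g"
begin

lemma metric_smooth: "k \<in> \<A> \<Longrightarrow> smooth_on (chart_range k) (\<lambda>u. g k (chart_inv k u))"
  using g by (simp add: riemannian_metric_def)

lemma metric_pos: "k \<in> \<A> \<Longrightarrow> x \<in> chart_dom k \<Longrightarrow> v \<noteq> 0 \<Longrightarrow> v \<bullet> (g k x *v v) > 0"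
  using g by (simp add: riemannian_metric_def)

lemma metric_det_pos: "k \<in> \<A> \<Longrightarrow> x \<in> chart_dom k \<Longrightarrow> det (g k x) > 0"
  by (intro det_positive_definite metric_pos)

lemma metric_det_pos_chart: "k \<in> \<A> \<Longrightarrow> u \<in> chart_range k \<Longrightarrow> det (g k (chart_inv k u)) > 0"
  by (intro metric_det_pos chart_simps(4)[OF \<A>])

lemma continuous_on_volume_density:
  assumes "k \<in> \<A>"
  shows "continuous_on (chart_range k) (\<lambda>u. sqrt (det (g k (chart_inv k u))))"
proof -
  have c: "continuous_on (chart_range k) (\<lambda>u. g k (chart_inv k u))"
    using metric_smooth[OF assms] by (rule smooth_on_imp_continuous_on)
  show ?thesis
    unfolding det_def by (intro continuous_intros c)
qed

text \<open>All conditions on a metric are homogeneous in it. The fact is needed because uniqueness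
  of the heat kernel is applied to the rescaled metric.\<close>

lemma scale_metric_riemannian:
  assumes "r > 0"
  shows "riemannian_metric \<A> (scale_metric r g)"
proof -
  have smooth: "smooth_on (chart_range k) (\<lambda>u. scale_metric r g k (chart_inv k u))" if "k \<in> \<A>" for k
    by (rule smooth_on_cmult[OF smooth_atlasD(2)[OF \<A> that] metric_smooth[OF that], of _ r])
      (simp add: scale_metric_def)
  have pos: "v \<bullet> (scale_metric r g k x *v v) > 0" if "k \<in> \<A>" "x \<in> chart_dom k" "v \<noteq> 0" for k x v
    using metric_pos[OF that] assms
    by (simp add: scale_metric_def flip: scaleR_matrix_vector_assoc)
  have sym: "transpose (scale_metric r g k x) = scale_metric r g k x"
    if "k \<in> \<A>" "x \<in> chart_dom k" for k x
    using g that by (simp add: riemannian_metric_def scale_metric_def transpose_scalar)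
  have trans: "scale_metric r g k x = transpose J ** scale_metric r g l x ** J"
    if "k \<in> \<A>" "l \<in> \<A>" "x \<in> chart_dom k \<inter> chart_dom l"
      "J = matrix (frechet_derivative (transition k l) (at (chart_map k x)))" for k l x J
  proof -
    have "g k x = transpose J ** g l x ** J"
      using g that unfolding riemannian_metric_def Let_def by blast
    then show ?thesis
      by (simp add: scale_metric_def matrix_scalar_ac flip: scalar_matrix_assoc)
  qed
  show ?thesis
    unfolding riemannian_metric_def Let_def using smooth pos sym trans by blast
qed

text \<open>\<open>frechet_derivative\<close> is an arbitrary choice where no derivative exists, so
  a constant may leave the outer derivative of the Laplacian only once the flux is known to be
  differentiable. The square root causes no trouble since the determinant is positive.\<close>

lemma differentiable_laplacian_flux:
  fixes f :: "'a \<Rightarrow> real"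
  assumes k: "k \<in> \<A>" and f: "smooth_on (chart_range k) (\<lambda>u. f (chart_inv k u))"
    and p: "p \<in> chart_range k"
  shows "(\<lambda>u. \<Sum>j\<in>UNIV. sqrt (det (g k (chart_inv k u))) * matrix_inv (g k (chart_inv k u)) $ i $ j *
    partial_deriv j (\<lambda>u. f (chart_inv k u)) u) differentiable (at p)"
proof -
  have "(\<lambda>u. g k (chart_inv k u)) differentiable (at p)"
    using metric_smooth[OF k] p by (rule smooth_on_imp_differentiable)
  then obtain D where "((\<lambda>u. g k (chart_inv k u)) has_derivative D) (at p)"
    by (auto simp: differentiable_def)
  then have "((\<lambda>u. g k (chart_inv k u) $ i $ j) has_derivative (\<lambda>v. D v $ i $ j)) (at p)" for i j
    by (intro bounded_linear.has_derivative[OF bounded_linear_vec_nth])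
  then have G: "(\<lambda>u. g k (chart_inv k u) $ i $ j) differentiable (at p)" for i j
    unfolding differentiable_def by blast
  then have "(\<lambda>u. det (g k (chart_inv k u))) differentiable (at p)"
    by (rule differentiable_det)
  moreover have "sqrt differentiable (at (det (g k (chart_inv k p))))"
    using DERIV_real_sqrt[OF metric_det_pos_chart[OF k p]] real_differentiable_def by blast
  ultimately have w: "(\<lambda>u. sqrt (det (g k (chart_inv k u)))) differentiable (at p)"
    using differentiable_chain_at by (fastforce simp: o_def)
  have inv: "(\<lambda>u. matrix_inv (g k (chart_inv k u)) $ i $ j) differentiable (at p)" for i j
    using metric_det_pos_chart[OF k]
    by (intro differentiable_matrix_inv_nth[OF G smooth_atlasD(2)[OF \<A> k] p]) (metis less_irrefl)
  have "(\<lambda>u. partial_deriv j (\<lambda>u. f (chart_inv k u)) u) differentiable (at p)" for j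
    unfolding partial_deriv_def
    by (rule smooth_on_imp_differentiable[OF smooth_on_frechet_derivative[OF f] p])
  with w inv show ?thesis
    by (intro differentiable_sum differentiable_mult) auto
qed

text \<open>The ratio \<open>\<kappa>\<close> of the two volume densities multiplies the flux as
  well as the outer denominator and cancels. What remains is the factor 1 / r of the inverse
  matrix.\<close>

lemma laplace_beltrami_scale_metric:
  assumes r: "r > 0" and f: "f \<in> test_functions \<A> M"
  shows "laplace_beltrami \<A> (scale_metric r g) f x = laplace_beltrami \<A> g f x / r"
proof -
  define k where "k = chart_at \<A> x"
  define p where "p = chart_map k x"
  define G where "G u = g k (chart_inv k u)" for u
  define F where "F u = f (chart_inv k u)" for u
  define \<kappa> where "\<kappa> = sqrt (r ^ CARD('d))"
  define w where "w u = sqrt (det (G u))" for u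
  define \<Phi> where "\<Phi> i u = (\<Sum>j\<in>UNIV. w u * matrix_inv (G u) $ i $ j * partial_deriv j F u)" for i u
  define \<Phi>' where "\<Phi>' i u =
    (\<Sum>j\<in>UNIV. (\<kappa> * w u) * matrix_inv (r *\<^sub>R G u) $ i $ j * partial_deriv j F u)" for i u
  have k: "k \<in> \<A>" and x: "x \<in> chart_dom k"
    using chart_at_in[OF \<A>] by (auto simp: k_def)
  then have p: "p \<in> chart_range k" unfolding p_def by (intro chart_simps(3)[OF \<A>])
  have "\<kappa> > 0" using r by (simp add: \<kappa>_def)
  have "smooth_on (chart_range k) F"
    using f k by (auto simp: test_functions_def F_def[abs_def])
  then have diff: "\<Phi> i differentiable (at p)" for i
    using differentiable_laplacian_flux[OF k _ p, of f i]
    by (simp add: \<Phi>_def[abs_def] w_def G_def F_def[abs_def])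
  have "partial_deriv i (\<Phi>' i) p = (\<kappa> / r) * partial_deriv i (\<Phi> i) p" for i
  proof -
    have "(\<kappa> / r) * \<Phi> i u = \<Phi>' i u" if "u \<in> chart_range k" for u
    proof -
      have "det (G u) \<noteq> 0" using metric_det_pos_chart[OF k that] by (simp add: G_def)
      then have "matrix_inv (r *\<^sub>R G u) = (1 / r) *\<^sub>R matrix_inv (G u)"
        using r by (intro matrix_inv_scaleR) auto
      then show ?thesis
        by (simp add: \<Phi>_def \<Phi>'_def sum_distrib_left mult_ac)
    qed
    \<comment> \<open>The two fluxes are compared only on the chart range, where the metric is
      nonsingular; this is an open set around \<open>p\<close>, so the derivatives at
      \<open>p\<close> agree.\<close>
    then have "frechet_derivative (\<lambda>u. (\<kappa> / r) * \<Phi> i u) (at p) = frechet_derivative (\<Phi>' i) (at p)"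
      by (intro frechet_derivative_transform_within_open[OF _ smooth_atlasD(2)[OF \<A> k] p]
          differentiable_mult differentiable_const diff)
    moreover have "frechet_derivative (\<lambda>u. (\<kappa> / r) * \<Phi> i u) (at p)
        = (\<lambda>v. (\<kappa> / r) * frechet_derivative (\<Phi> i) (at p) v)"
      by (rule frechet_derivative_cmult[OF diff])
    ultimately show ?thesis by (simp add: partial_deriv_def fun_eq_iff)
  qed
  then have "(\<Sum>i\<in>UNIV. partial_deriv i (\<Phi>' i) p) / (\<kappa> * w p)
      = ((\<Sum>i\<in>UNIV. partial_deriv i (\<Phi> i) p) / w p) / r"
    using \<open>\<kappa> > 0\<close> by (simp flip: sum_distrib_left sum_divide_distrib)
  moreover have "laplace_beltrami \<A> (scale_metric r g) f x
      = (\<Sum>i\<in>UNIV. partial_deriv i (\<Phi>' i) p) / (\<kappa> * w p)"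
    by (simp add: laplace_beltrami_def scale_metric_def Let_def det_scaleR real_sqrt_mult
        \<Phi>'_def[abs_def] w_def G_def F_def[abs_def] p_def k_def \<kappa>_def)
  moreover have "laplace_beltrami \<A> g f x = (\<Sum>i\<in>UNIV. partial_deriv i (\<Phi> i) p) / w p"
    by (simp add: laplace_beltrami_def Let_def
        \<Phi>_def[abs_def] w_def G_def F_def[abs_def] p_def k_def)
  ultimately show ?thesis by simp
qed

lemma grad_norm_sq_scale_metric:
  assumes "r > 0"
  shows "grad_norm_sq \<A> (scale_metric r g) f x = grad_norm_sq \<A> g f x / r"
proof -
  have "det (g (chart_at \<A> x) x) \<noteq> 0"
    using metric_det_pos[OF chart_at_in[OF \<A>, of x]] by simp
  then have "matrix_inv (r *\<^sub>R g (chart_at \<A> x) x) = (1 / r) *\<^sub>R matrix_inv (g (chart_at \<A> x) x)"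
    using assms by (intro matrix_inv_scaleR) auto
  then show ?thesis
    by (simp add: grad_norm_sq_def Let_def scale_metric_def sum_divide_distrib)
qed

section \<open>The Riemannian measure\<close>

text \<open>The density is continuous on the chart range and arbitrary elsewhere, hence the cut-off.
  Measurability is what allows a constant factor to leave the integral.\<close>

lemma measurable_volume_density:
  assumes "k \<in> \<A>" "B \<in> sets borel" "B \<subseteq> chart_dom k"
  shows "(\<lambda>u. ennreal (sqrt (det (g k (chart_inv k u)))) * indicator (chart_map k ` B) u) \<in> borel_measurable lborel"
proof -
  let ?w = "\<lambda>u. sqrt (det (g k (chart_inv k u)))"
  have "chart_map k ` B \<subseteq> chart_range k"
    using assms(3) by (auto simp: chart_range_def)
  then have "continuous_on (chart_map k ` B) ?w"
    using continuous_on_volume_density[OF assms(1)] continuous_on_subset by blast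
  then have "(\<lambda>u. indicator (chart_map k ` B) u *\<^sub>R ?w u) \<in> borel_measurable borel"
    by (rule borel_measurable_continuous_on_indicator[OF borel_chart_image[OF \<A> assms]])
  then have "(\<lambda>u. ennreal (indicator (chart_map k ` B) u *\<^sub>R ?w u)) \<in> borel_measurable lborel"
    by simp
  also have "(\<lambda>u. ennreal (indicator (chart_map k ` B) u *\<^sub>R ?w u)) =
      (\<lambda>u. ennreal (?w u) * indicator (chart_map k ` B) u)"
    by (auto simp: fun_eq_iff indicator_def)
  finally show ?thesis .
qed

lemma riemannian_measure_scale_metric:
  assumes r: "r > 0" and V: "riemannian_measure \<A> g V"
  shows "riemannian_measure \<A> (scale_metric r g) (density V (\<lambda>_. ennreal (sqrt (r ^ CARD('d)))))"
proof -
  let ?c = "sqrt (r ^ CARD('d))"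
  have "emeasure (density V (\<lambda>_. ennreal ?c)) B =
      (\<integral>\<^sup>+u\<in>chart_map k ` B. ennreal (sqrt (det (scale_metric r g k (chart_inv k u)))) \<partial>lborel)"
    if k: "k \<in> \<A>" and B: "B \<in> sets borel" "B \<subseteq> chart_dom k" for k B
  proof -
    have "emeasure (density V (\<lambda>_. ennreal ?c)) B = ennreal ?c * emeasure V B"
      using B V by (intro emeasure_density_const) (simp add: riemannian_measure_def)
    also have "\<dots> = ennreal ?c *
        (\<integral>\<^sup>+u\<in>chart_map k ` B. ennreal (sqrt (det (g k (chart_inv k u)))) \<partial>lborel)"
      using V k B by (simp add: riemannian_measure_def)
    also have "\<dots> = (\<integral>\<^sup>+u. ennreal ?c *
        (ennreal (sqrt (det (g k (chart_inv k u)))) * indicator (chart_map k ` B) u) \<partial>lborel)"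
      by (rule nn_integral_cmult[symmetric, OF measurable_volume_density[OF k B]])
    also have "\<dots> = (\<integral>\<^sup>+u\<in>chart_map k ` B. ennreal (sqrt (det (scale_metric r g k (chart_inv k u)))) \<partial>lborel)"
      using r by (intro nn_integral_cong)
        (simp add: scale_metric_def det_scaleR real_sqrt_mult ennreal_mult' mult.assoc)
    finally show ?thesis .
  qed
  then show ?thesis
    using V by (simp add: riemannian_measure_def)
qed

text \<open>The defining formula prescribes the measure only of sets inside one chart. By second
  countability countably many charts cover the space; making them disjoint cuts any Borel set into
  pieces on which the formula applies.\<close>

lemma riemannian_measure_unique:
  assumes V: "riemannian_measure \<A> g V" and W: "riemannian_measure \<A> g W"
  shows "V = W"
proof (rule measure_eqI)
  show sets: "sets V = sets W" using V W by (simp add: riemannian_measure_def)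
  have sV: "sets V = sets borel" and sW: "sets W = sets borel"
    using V W by (auto simp: riemannian_measure_def)
  fix X assume X: "X \<in> sets V"
  obtain \<F> where \<F>: "\<F> \<subseteq> chart_dom ` \<A>" "countable \<F>" "\<Union>\<F> = \<Union>(chart_dom ` \<A>)"
    using Lindelof[of "chart_dom ` \<A>"] smooth_atlasD(1)[OF \<A>] by (metis imageE)
  have cover: "\<Union>\<F> = UNIV" using \<F>(3) \<A> by (simp add: smooth_atlas_def)
  then have "\<F> \<noteq> {}" by auto
  define D where "D = from_nat_into \<F>"
  have D_in: "D n \<in> chart_dom ` \<A>" for n
    unfolding D_def using from_nat_into[OF \<open>\<F> \<noteq> {}\<close>] \<F>(1) by blast
  have UN_D: "(\<Union>n. D n) = UNIV"
    unfolding D_def using cover range_from_nat_into[OF \<open>\<F> \<noteq> {}\<close> \<F>(2)] by simp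
  have "open (D n)" for n using D_in[of n] smooth_atlasD(1)[OF \<A>] by auto
  then have D_borel: "range D \<subseteq> sets borel" by auto
  define B where "B n = X \<inter> disjointed D n" for n
  have "disjointed D n \<in> sets borel" for n
    using sets.range_disjointed_sets[OF D_borel] by auto
  then have B_borel: "B n \<in> sets borel" for n using X sV by (auto simp: B_def)
  have B_eq: "emeasure V (B n) = emeasure W (B n)" for n
  proof -
    obtain k where k: "k \<in> \<A>" "D n = chart_dom k" using D_in by blast
    then have "B n \<subseteq> chart_dom k" using disjointed_subset[of D n] by (auto simp: B_def)
    then show ?thesis using V W k B_borel by (simp add: riemannian_measure_def)
  qed
  have disj: "disjoint_family B"
    using disjoint_family_disjointed[of D] by (auto simp: disjoint_family_on_def B_def)
  have "(\<Union>n. B n) = X" using UN_disjointed_eq[of D] UN_D by (auto simp: B_def)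
  then have "(\<lambda>n. emeasure V (B n)) sums emeasure V X" "(\<lambda>n. emeasure W (B n)) sums emeasure W X"
    using sums_emeasure[OF disj, of V] sums_emeasure[OF disj, of W] B_borel sV sW by auto
  then show "emeasure V X = emeasure W X"
    using B_eq by (simp add: sums_iff)
qed

text \<open>A small coordinate ball works, its volume density lying between two positive constants.
  Finiteness puts the indicator into \<open>L2\<close>; positivity prevents an almost-everywhere
  statement from missing the whole neighbourhood.\<close>

lemma riemannian_measure_small_neighbourhood:
  assumes V: "riemannian_measure \<A> g V" and W: "open W" "y \<in> W"
  shows "\<exists>B. open B \<and> y \<in> B \<and> B \<subseteq> W \<and> 0 < emeasure V B \<and> emeasure V B < \<infinity>"
proof -
  define k where "k = chart_at \<A> y"
  define w where "w u = sqrt (det (g k (chart_inv k u)))" for u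
  have k: "k \<in> \<A>" and y: "y \<in> chart_dom k"
    using chart_at_in[OF \<A>] by (auto simp: k_def)
  have "open (chart_map k ` (W \<inter> chart_dom k))"
    using W smooth_atlasD(1)[OF \<A> k] by (intro open_chart_image[OF \<A> k]) auto
  moreover have "chart_map k y \<in> chart_map k ` (W \<inter> chart_dom k)"
    using W y by (intro imageI IntI)
  \<comment> \<open>The closed ball is compact, so the density attains its extrema on it; the
    neighbourhood itself comes from the open ball.\<close>
  ultimately obtain e where e: "e > 0" "cball (chart_map k y) e \<subseteq> chart_map k ` (W \<inter> chart_dom k)"
    by (auto simp: open_contains_cball_eq)
  let ?C = "cball (chart_map k y) e" and ?U = "ball (chart_map k y) e"
  have C: "?C \<subseteq> chart_range k" using e(2) by (auto simp: chart_range_def)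
  define B where "B = chart_dom k \<inter> chart_map k -` ?U"
  have "open B"
    unfolding B_def using smooth_atlasD[OF \<A> k] homeomorphism_cont1
    by (intro continuous_open_preimage) auto
  have yB: "y \<in> B" using y e by (simp add: B_def)
  have BW: "B \<subseteq> W"
  proof
    fix x assume "x \<in> B"
    then have "x \<in> chart_dom k" "chart_map k x \<in> chart_map k ` (W \<inter> chart_dom k)"
      using e(2) by (auto simp: B_def)
    then obtain z where z: "z \<in> W" "z \<in> chart_dom k" "chart_map k x = chart_map k z" by blast
    have "x = chart_inv k (chart_map k x)"
      using \<open>x \<in> chart_dom k\<close> by (rule chart_simps(1)[OF \<A> k, symmetric])
    also have "\<dots> = z" unfolding z(3) using z(2) by (rule chart_simps(1)[OF \<A> k])
    finally show "x \<in> W" using z(1) by (rule ssubst)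
  qed
  have im: "chart_map k ` B = ?U"
  proof (intro equalityI subsetI)
    fix u assume u: "u \<in> ?U"
    then have "u \<in> chart_range k" using C ball_subset_cball by blast
    then have "chart_map k (chart_inv k u) = u" "chart_inv k u \<in> chart_dom k"
      using chart_simps(2,4)[OF \<A> k] by auto
    then show "u \<in> chart_map k ` B"
      using u by (intro image_eqI[of _ _ "chart_inv k u"]) (auto simp: B_def)
  qed (auto simp: B_def)
  have "continuous_on ?C w"
    unfolding w_def using continuous_on_subset[OF continuous_on_volume_density[OF k] C] .
  moreover have "?C \<noteq> {}" using e by auto
  ultimately obtain a b where a: "a \<in> ?C" "\<forall>u\<in>?C. w a \<le> w u" and b: "\<forall>u\<in>?C. w u \<le> w b"
    using continuous_attains_inf[OF compact_cball, of "chart_map k y" e w]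
      continuous_attains_sup[OF compact_cball, of "chart_map k y" e w] by blast
  have "w a > 0" using a(1) C metric_det_pos_chart[OF k] by (auto simp: w_def)
  have vol: "emeasure V B = (\<integral>\<^sup>+u\<in>?U. ennreal (w u) \<partial>lborel)"
    using V k \<open>open B\<close> im by (simp add: riemannian_measure_def w_def B_def)
  have ball_pos: "emeasure lborel ?U > 0"
    using content_ball_pos[OF e(1), of "chart_map k y"]
    by (metis enn2real_0 less_irrefl measure_def zero_less_iff_neq_zero)
  have "0 < ennreal (w a) * emeasure lborel ?U"
    using ball_pos \<open>w a > 0\<close> by (simp add: ennreal_zero_less_mult_iff)
  also have "\<dots> = (\<integral>\<^sup>+u\<in>?U. ennreal (w a) \<partial>lborel)"
    by (simp add: nn_integral_cmult_indicator)
  also have "\<dots> \<le> emeasure V B"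
    unfolding vol using a by (intro nn_integral_mono) (auto simp: indicator_def intro!: ennreal_leI)
  finally have pos: "0 < emeasure V B" .
  have "emeasure V B \<le> (\<integral>\<^sup>+u\<in>?U. ennreal (w b) \<partial>lborel)"
    unfolding vol using b by (intro nn_integral_mono) (auto simp: indicator_def intro!: ennreal_leI)
  also have "\<dots> = ennreal (w b) * emeasure lborel ?U"
    by (simp add: nn_integral_cmult_indicator)
  also have "\<dots> < \<infinity>"
    using emeasure_lborel_ball_finite[of "chart_map k y" e] by (simp add: ennreal_mult_less_top)
  finally show ?thesis using \<open>open B\<close> yB BW pos by blast
qed

end

section \<open>Uniqueness of the heat kernel\<close>

lemma smooth_kernel_continuous:
  assumes \<A>: "smooth_atlas \<A>" and h: "smooth_kernel \<A> M h" and "k \<in> \<A>" "l \<in> \<A>"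
  shows "continuous_on ((chart_dom k \<inter> M) \<times> (chart_dom l \<inter> M)) (\<lambda>(x, y). h x y)"
proof -
  let ?X = "chart_dom k \<inter> M" and ?Y = "chart_dom l \<inter> M"
  let ?c = "\<lambda>z. (chart_map k (fst z), chart_map l (snd z))"
  have "smooth_on (chart_map k ` ?X \<times> chart_map l ` ?Y) (\<lambda>(u, v). h (chart_inv k u) (chart_inv l v))"
    using h assms(3,4) by (simp add: smooth_kernel_def)
  then have F: "continuous_on (chart_map k ` ?X \<times> chart_map l ` ?Y) (\<lambda>(u, v). h (chart_inv k u) (chart_inv l v))"
    by (rule smooth_on_imp_continuous_on)
  have X: "continuous_on ?X (chart_map k)" and Y: "continuous_on ?Y (chart_map l)"
    using homeomorphism_cont1[OF smooth_atlasD(3)[OF \<A>]] assms(3,4)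
    by (meson Int_lower1 continuous_on_subset)+
  have "continuous_on (?X \<times> ?Y) (\<lambda>z. chart_map k (fst z))"
    by (rule continuous_on_compose2[OF X continuous_on_fst[OF continuous_on_id]]) auto
  moreover have "continuous_on (?X \<times> ?Y) (\<lambda>z. chart_map l (snd z))"
    by (rule continuous_on_compose2[OF Y continuous_on_snd[OF continuous_on_id]]) auto
  ultimately have "continuous_on (?X \<times> ?Y) ?c"
    by (intro continuous_on_Pair)
  then have "continuous_on (?X \<times> ?Y) (\<lambda>z. (\<lambda>(u, v). h (chart_inv k u) (chart_inv l v)) (?c z))"
    by (rule continuous_on_compose2[OF F]) auto
  then show ?thesis
    by (rule continuous_on_eq) (auto simp: chart_simps(1)[OF \<A>] assms(3,4))
qed

text \<open>If \<open>h\<close> exceeded \<open>h'\<close> at one point, it would do so on a product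
  of neighbourhoods. Testing both operators on the indicator of a small set \<open>B\<close> around
  \<open>y\<close> would then give different values at all points near \<open>x\<close>, although
  they agree almost everywhere.\<close>

lemma integral_kernel_le:
  assumes \<A>: "smooth_atlas \<A>" and g: "riemannian_metric \<A> g" and M: "open M"
    and V: "riemannian_measure \<A> g V"
    and smooth: "smooth_kernel \<A> M h" "smooth_kernel \<A> M h'"
    and kernel: "integral_kernel (restrict_space V M) h T" "integral_kernel (restrict_space V M) h' T'"
    and T: "\<And>f. f \<in> L2 (restrict_space V M) \<Longrightarrow> AE x in restrict_space V M. T f x = T' f x"
    and xy: "x \<in> M" "y \<in> M"
  shows "h x y \<le> h' x y"
proof (rule ccontr)
  assume less: "\<not> h x y \<le> h' x y"
  let ?\<mu> = "restrict_space V M"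
  let ?k = "chart_at \<A> x" and ?l = "chart_at \<A> y"
  let ?S = "(chart_dom ?k \<inter> M) \<times> (chart_dom ?l \<inter> M)"
  have sV: "sets V = sets borel" using V by (simp add: riemannian_measure_def)
  have spV: "space V = UNIV" using sets_eq_imp_space_eq[OF sV] by simp
  have em: "emeasure ?\<mu> B = emeasure V B" if "B \<subseteq> M" for B
    using that M sV spV by (intro emeasure_restrict_space) auto
  have meas: "B \<in> sets ?\<mu>" if "open B" "B \<subseteq> M" for B
    using that M sV spV by (subst sets_restrict_space_iff) auto
  have "continuous_on ?S (\<lambda>(x, y). h x y)" "continuous_on ?S (\<lambda>(x, y). h' x y)"
    using smooth_kernel_continuous[OF \<A>] smooth chart_at_in(1)[OF \<A>] by blast+
  then have "continuous_on ?S (\<lambda>z. (\<lambda>(x, y). h x y) z - (\<lambda>(x, y). h' x y) z)"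
    by (rule continuous_on_diff)
  moreover have "open ?S"
    using M smooth_atlasD(1)[OF \<A> chart_at_in(1)[OF \<A>]] by (intro open_Times open_Int)
  ultimately have "open (?S \<inter> (\<lambda>z. (\<lambda>(x, y). h x y) z - (\<lambda>(x, y). h' x y) z) -` {0<..})"
    by (rule continuous_open_preimage) simp
  moreover have "(x, y) \<in> ?S \<inter> (\<lambda>z. (\<lambda>(x, y). h x y) z - (\<lambda>(x, y). h' x y) z) -` {0<..}"
    using xy chart_at_in(2)[OF \<A>] less by simp
  ultimately obtain U W where UW: "open U" "open W" "(x, y) \<in> U \<times> W"
    and sub: "U \<times> W \<subseteq> ?S \<inter> (\<lambda>z. (\<lambda>(x, y). h x y) z - (\<lambda>(x, y). h' x y) z) -` {0<..}"
    by (rule open_prod_elim)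
  have pos: "h' u w < h u w" if "u \<in> U" "w \<in> W" for u w
    using subsetD[OF sub, of "(u, w)"] that by simp
  have UM: "U \<subseteq> M" "W \<subseteq> M" using sub UW(3) by auto
  obtain B where B: "open B" "y \<in> B" "B \<subseteq> W" "0 < emeasure V B" "emeasure V B < \<infinity>"
    using riemannian_measure_small_neighbourhood[OF \<A> g V UW(2)] UW(3) by blast
  obtain C where C: "open C" "x \<in> C" "C \<subseteq> U" "0 < emeasure V C"
    using riemannian_measure_small_neighbourhood[OF \<A> g V UW(1)] UW(3) by blast
  have BM: "B \<subseteq> M" and CM: "C \<subseteq> M" using B C UM by auto
  have B_sets: "B \<in> sets ?\<mu>" and C_sets: "C \<in> sets ?\<mu>" using meas B C BM CM by auto
  let ?f = "indicator B :: 'a \<Rightarrow> real"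
  have sq: "(\<lambda>x. (?f x)\<^sup>2) = ?f" by (auto simp: indicator_def)
  have f: "?f \<in> L2 ?\<mu>"
    unfolding L2_def using B_sets B(5) em[OF BM] by (simp add: sq)
  have "AE z in ?\<mu>. integrable ?\<mu> (\<lambda>w. h z w * ?f w) \<and> integrable ?\<mu> (\<lambda>w. h' z w * ?f w) \<and>
      (\<integral>w. h z w * ?f w \<partial>?\<mu>) = (\<integral>w. h' z w * ?f w \<partial>?\<mu>)"
    using kernel[unfolded integral_kernel_def, THEN bspec, OF f] T[OF f]
    by eventually_elim simp
  \<comment> \<open>The exceptional null set depends on the test function, but only one is used. It
    cannot contain \<open>C\<close>, which has positive measure, so a good point \<open>z\<close>
    lies in \<open>C\<close>.\<close>
  moreover have "\<not> (AE z in ?\<mu>. z \<notin> C)"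
    using C(4) C_sets em[OF CM] by (subst AE_iff_measurable[of C]) (auto dest: sets.sets_into_space)
  ultimately obtain z where z: "z \<in> C" "integrable ?\<mu> (\<lambda>w. h z w * ?f w)" "integrable ?\<mu> (\<lambda>w. h' z w * ?f w)"
      "(\<integral>w. h z w * ?f w \<partial>?\<mu>) = (\<integral>w. h' z w * ?f w \<partial>?\<mu>)"
    by (smt (verit, best) eventually_mono)
  let ?D = "\<lambda>w. h z w * ?f w - h' z w * ?f w"
  have Dpos: "0 < ?D w" if "w \<in> B" for w
    using pos[of z w] z(1) C(3) B(3) that by auto
  then have "0 \<le> ?D w" for w by (cases "w \<in> B") (auto simp: less_imp_le)
  then have "AE w in ?\<mu>. ?D w = 0"
    using integral_nonneg_eq_0_iff_AE[of ?\<mu> ?D] z(2-4) by simp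
  then have "AE w in ?\<mu>. w \<notin> B"
    by (rule eventually_mono) (use Dpos in fastforce)
  then have "emeasure ?\<mu> B = 0"
    using B_sets by (subst (asm) AE_iff_measurable[of B]) (auto dest: sets.sets_into_space)
  then show False using B(4) em[OF BM] by simp
qed

lemma laplacian_unique: "laplacian \<A> g \<mu> M A \<Longrightarrow> laplacian \<A> g \<mu> M B \<Longrightarrow> A = B"
  by (auto simp: laplacian_def split: if_splits)

text \<open>The witnesses hidden in the two assumptions are identified in turn: the measure, the
  operator, the semigroup up to null sets. The kernels then agree pointwise by two one-sided
  comparisons.\<close>

lemma heat_kernel_unique:
  assumes \<A>: "smooth_atlas \<A>" and g: "riemannian_metric \<A> g" and M: "open M"
    and H: "heat_kernel \<A> g M H" and K: "heat_kernel \<A> g M K"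
    and t: "t > 0" and xy: "x \<in> M" "y \<in> M"
  shows "H t x y = K t x y"
proof -
  obtain V A P where H': "riemannian_measure \<A> g V" "laplacian \<A> g (restrict_space V M) M A"
    "heat_semigroup (restrict_space V M) A P"
    "smooth_kernel \<A> M (H t)" "integral_kernel (restrict_space V M) (H t) (P t)"
    using H t unfolding heat_kernel_def by blast
  obtain W B Q where K': "riemannian_measure \<A> g W" "laplacian \<A> g (restrict_space W M) M B"
    "heat_semigroup (restrict_space W M) B Q"
    "smooth_kernel \<A> M (K t)" "integral_kernel (restrict_space W M) (K t) (Q t)"
    using K t unfolding heat_kernel_def by blast
  have "W = V" using riemannian_measure_unique[OF \<A> g K'(1) H'(1)] .
  note K' = K'[unfolded this]
  have "B = A" using laplacian_unique[OF K'(2) H'(2)] .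
  note K' = K'[unfolded this]
  have PQ: "AE x in restrict_space V M. P t f x = Q t f x" if "f \<in> L2 (restrict_space V M)" for f
    using semigroup_unique[OF H'(3) K'(3) that] t by simp
  have QP: "AE x in restrict_space V M. Q t f x = P t f x" if "f \<in> L2 (restrict_space V M)" for f
    using PQ[OF that] by (rule eventually_mono) simp
  show ?thesis
    using integral_kernel_le[OF \<A> g M H'(1) H'(4) K'(4) H'(5) K'(5) PQ xy]
      integral_kernel_le[OF \<A> g M H'(1) K'(4) H'(4) K'(5) H'(5) QP xy] by simp
qed

section \<open>Scaling of the heat kernel\<close>

lemma integrable_density_const:
  fixes f :: "'a \<Rightarrow> real"
  assumes "\<kappa> > 0"
  shows "integrable (density \<mu> (\<lambda>_. ennreal \<kappa>)) f \<longleftrightarrow> integrable \<mu> f"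
proof (cases "f \<in> borel_measurable \<mu>")
  case True
  then show ?thesis using assms by (subst integrable_density) auto
qed (auto dest: borel_measurable_integrable)

text \<open>No integrability is assumed: a constant density does not affect it, and in its absence
  both integrals have the default value 0. Inner products and norms therefore scale
  unconditionally.\<close>

lemma integral_density_const:
  fixes f :: "'a \<Rightarrow> real"
  assumes "\<kappa> > 0"
  shows "(\<integral>x. f x \<partial>density \<mu> (\<lambda>_. ennreal \<kappa>)) = \<kappa> * (\<integral>x. f x \<partial>\<mu>)"
proof (cases "integrable \<mu> f")
  case True
  then show ?thesis using assms by (subst integral_density) auto
next
  case False
  then show ?thesis using integrable_density_const[OF assms, of \<mu> f] by (simp add: not_integrable_integral_eq)
qed

lemma AE_density_const:
  assumes "\<kappa> > 0"
  shows "(AE x in density \<mu> (\<lambda>_. ennreal \<kappa>). \<Phi> x) \<longleftrightarrow> (AE x in \<mu>. \<Phi> x)"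
  using assms by (subst AE_density) auto

lemma restrict_space_density_const:
  assumes "M \<inter> space V \<in> sets V"
  shows "restrict_space (density V (\<lambda>_. c)) M = density (restrict_space V M) (\<lambda>_. c)"
proof (rule measure_eqI)
  show sets: "sets (restrict_space (density V (\<lambda>_. c)) M) = sets (density (restrict_space V M) (\<lambda>_. c))"
    by (simp add: sets_restrict_space)
  fix X assume "X \<in> sets (restrict_space (density V (\<lambda>_. c)) M)"
  then have X: "X \<in> sets (restrict_space V M)" by (simp add: sets)
  then have "X \<subseteq> M" "X \<in> sets V" using assms by (simp_all add: sets_restrict_space_iff)
  then show "emeasure (restrict_space (density V (\<lambda>_. c)) M) X = emeasure (density (restrict_space V M) (\<lambda>_. c)) X"
    using X assms by (simp add: emeasure_restrict_space emeasure_density_const)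
qed

lemma L2_density_const: "\<kappa> > 0 \<Longrightarrow> L2 (density \<mu> (\<lambda>_. ennreal \<kappa>)) = L2 \<mu>"
  by (simp add: L2_def integrable_density_const)

lemma l2_inner_density_const:
  "\<kappa> > 0 \<Longrightarrow> l2_inner (density \<mu> (\<lambda>_. ennreal \<kappa>)) f h = \<kappa> * l2_inner \<mu> f h"
  by (simp add: l2_inner_def integral_density_const)

lemma l2_norm_density_const:
  "\<kappa> > 0 \<Longrightarrow> l2_norm (density \<mu> (\<lambda>_. ennreal \<kappa>)) f = sqrt \<kappa> * l2_norm \<mu> f"
  by (simp add: l2_norm_def integral_density_const real_sqrt_mult)

lemma tendsto_mult_left_0_iff:
  fixes f :: "'a \<Rightarrow> real"
  assumes "c \<noteq> 0"
  shows "((\<lambda>x. c * f x) \<longlongrightarrow> 0) F \<longleftrightarrow> (f \<longlongrightarrow> 0) F"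
  using tendsto_mult_left_iff[OF assms, of f 0 F] by simp

lemma l2_norm_density_const_tendsto:
  assumes "\<kappa> > 0"
  shows "((\<lambda>t. l2_norm (density \<mu> (\<lambda>_. ennreal \<kappa>)) (f t)) \<longlongrightarrow> 0) F \<longleftrightarrow> ((\<lambda>t. l2_norm \<mu> (f t)) \<longlongrightarrow> 0) F"
  using assms by (simp add: l2_norm_density_const tendsto_mult_left_0_iff)

text \<open>The factor \<open>\<kappa>\<close> stands on both sides of the adjoint relation and
  cancels; in the density condition it only rescales \<open>e\<close>.\<close>

lemma self_adjoint_op_density_const:
  assumes \<kappa>: "\<kappa> > 0"
  shows "self_adjoint_op (density \<mu> (\<lambda>_. ennreal \<kappa>)) A \<longleftrightarrow> self_adjoint_op \<mu> A"
proof -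
  let ?\<nu> = "density \<mu> (\<lambda>_. ennreal \<kappa>)"
  have "(\<forall>e>0. \<exists>(u, h)\<in>A. l2_norm ?\<nu> (\<lambda>x. f x - u x) < e) \<longleftrightarrow>
      (\<forall>e>0. \<exists>(u, h)\<in>A. l2_norm \<mu> (\<lambda>x. f x - u x) < e)" (is "?l \<longleftrightarrow> ?r") for f
  proof -
    have eq: "l2_norm ?\<nu> u < sqrt \<kappa> * e \<longleftrightarrow> l2_norm \<mu> u < e" for u e
      using \<kappa> by (simp add: l2_norm_density_const)
    show ?thesis
    proof
      assume ?l
      show ?r
      proof (intro allI impI)
        fix e :: real assume "e > 0"
        then have "\<exists>(u, h)\<in>A. l2_norm ?\<nu> (\<lambda>x. f x - u x) < sqrt \<kappa> * e"
          using \<open>?l\<close>[rule_format, of "sqrt \<kappa> * e"] \<kappa> by simp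
        then show "\<exists>(u, h)\<in>A. l2_norm \<mu> (\<lambda>x. f x - u x) < e" by (simp only: eq)
      qed
    next
      assume ?r
      show ?l
      proof (intro allI impI)
        fix e :: real assume "e > 0"
        then have "\<exists>(u, h)\<in>A. l2_norm \<mu> (\<lambda>x. f x - u x) < e / sqrt \<kappa>"
          using \<open>?r\<close>[rule_format, of "e / sqrt \<kappa>"] \<kappa> by simp
        then show "\<exists>(u, h)\<in>A. l2_norm ?\<nu> (\<lambda>x. f x - u x) < e"
          using \<kappa> by (simp add: eq[symmetric])
      qed
    qed
  qed
  then have "densely_defined ?\<nu> A = densely_defined \<mu> A"
    by (simp only: densely_defined_def L2_density_const[OF \<kappa>])
  moreover have "adjoint_graph ?\<nu> A = adjoint_graph \<mu> A"
    using \<kappa> by (simp add: adjoint_graph_def L2_density_const l2_inner_density_const)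
  ultimately show ?thesis
    using \<kappa> by (simp only: self_adjoint_op_def L2_density_const)
qed

section \<open>Division of an operator by a constant\<close>

text \<open>The graph of the operator \<open>A / r\<close>.\<close>
definition divide_graph :: "'a operator_graph \<Rightarrow> real \<Rightarrow> 'a operator_graph" where
  "divide_graph A r = {(u, h). (u, \<lambda>x. r * h x) \<in> A}"

lemma divide_graph_iff: "(u, h) \<in> divide_graph A r \<longleftrightarrow> (u, \<lambda>x. r * h x) \<in> A"
  by (simp add: divide_graph_def)

lemma divide_graph_inverse:
  assumes "r * s = 1"
  shows "divide_graph (divide_graph A r) s = A"
  using assms by (auto simp: divide_graph_def simp flip: mult.assoc)

lemma L2_cmult_iff: "c \<noteq> 0 \<Longrightarrow> (\<lambda>x. c * f x) \<in> L2 \<mu> \<longleftrightarrow> f \<in> L2 \<mu>"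
  using L2_cmult[of "\<lambda>x. c * f x" \<mu> "1 / c"] by (auto intro: L2_cmult)

text \<open>The constant is real, so it passes through either argument of the inner product: the
  adjoint relation for A / r at \<open>(u, f)\<close> is the one for \<open>A\<close> at
  \<open>(u, r * f)\<close>.\<close>

lemma self_adjoint_op_divide_graph:
  assumes A: "self_adjoint_op \<mu> A" and r: "r \<noteq> 0"
  shows "self_adjoint_op \<mu> (divide_graph A r)"
proof -
  have sub: "A \<subseteq> L2 \<mu> \<times> L2 \<mu>" and dense: "densely_defined \<mu> A" and adj: "A = adjoint_graph \<mu> A"
    using A unfolding self_adjoint_op_def by blast+
  have div: "(v, \<lambda>x. h x / r) \<in> divide_graph A r" if "(v, h) \<in> A" for v h
    using that r by (simp add: divide_graph_iff)
  have "divide_graph A r \<subseteq> L2 \<mu> \<times> L2 \<mu>"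
    using sub L2_cmult_iff[OF r] by (auto simp: divide_graph_def)
  moreover have "densely_defined \<mu> (divide_graph A r)"
    unfolding densely_defined_def
  proof (intro ballI allI impI)
    fix f and e :: real assume "f \<in> L2 \<mu>" "e > 0"
    then obtain u h where "(u, h) \<in> A" "l2_norm \<mu> (\<lambda>x. f x - u x) < e"
      using dense unfolding densely_defined_def by blast
    then show "\<exists>(u, h)\<in>divide_graph A r. l2_norm \<mu> (\<lambda>x. f x - u x) < e"
      using div by blast
  qed
  moreover have "(u, f) \<in> divide_graph A r \<longleftrightarrow> (u, f) \<in> adjoint_graph \<mu> (divide_graph A r)" for u f
  proof -
    have inner: "l2_inner \<mu> (\<lambda>x. r * h x) u = r * l2_inner \<mu> h u"
      "l2_inner \<mu> u (\<lambda>x. r * h x) = r * l2_inner \<mu> u h" for h u :: "'a \<Rightarrow> real"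
      by (simp_all add: l2_inner_def mult.assoc mult.left_commute[of _ r])
    have "(u, f) \<in> divide_graph A r \<longleftrightarrow> (u, \<lambda>x. r * f x) \<in> adjoint_graph \<mu> A"
      using adj by (simp add: divide_graph_iff)
    also have "\<dots> \<longleftrightarrow> u \<in> L2 \<mu> \<and> f \<in> L2 \<mu> \<and> (\<forall>(v, h)\<in>A. l2_inner \<mu> h u = r * l2_inner \<mu> v f)"
      by (simp add: adjoint_graph_def L2_cmult_iff[OF r] inner)
    also have "(\<forall>(v, h)\<in>A. l2_inner \<mu> h u = r * l2_inner \<mu> v f) \<longleftrightarrow>
        (\<forall>(v, h)\<in>divide_graph A r. l2_inner \<mu> h u = l2_inner \<mu> v f)" (is "?l \<longleftrightarrow> ?r")
    proof
      assume ?l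
      then show ?r using r by (auto simp: divide_graph_def inner)
    next
      assume R: ?r
      show ?l
      proof clarify
        fix v h assume "(v, h) \<in> A"
        then have "l2_inner \<mu> (\<lambda>x. h x / r) u = l2_inner \<mu> v f"
          using div R by blast
        then show "l2_inner \<mu> h u = r * l2_inner \<mu> v f"
          using inner(1)[of "\<lambda>x. h x / r" u] r by simp
      qed
    qed
    finally show ?thesis by (simp add: adjoint_graph_def)
  qed
  then have "divide_graph A r = adjoint_graph \<mu> (divide_graph A r)"
    by (intro set_eqI) (metis surj_pair)
  ultimately show ?thesis unfolding self_adjoint_op_def by blast
qed

text \<open>By the chain rule the derivative at zero of the slowed semigroup is 1 / r times the old
  one. The new measure has the same null sets and multiplies norms by a constant, so neither
  almost-everywhere statements nor limits to zero notice it.\<close>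

lemma heat_semigroup_scale:
  assumes P: "heat_semigroup \<mu> A P" and \<kappa>: "\<kappa> > 0" and r: "r > 0"
  shows "heat_semigroup (density \<mu> (\<lambda>_. ennreal \<kappa>)) (divide_graph A r) (\<lambda>t. P (t / r))"
proof -
  let ?\<nu> = "density \<mu> (\<lambda>_. ennreal \<kappa>)"
  \<comment> \<open>Multiplication by a positive constant maps the filter of right neighbourhoods of
    0 to itself.\<close>
  have lim: "((\<lambda>t. \<Phi> (t / r)) \<longlongrightarrow> 0) (at_right 0) \<longleftrightarrow> (\<Phi> \<longlongrightarrow> 0) (at_right 0)" for \<Phi> :: "real \<Rightarrow> real"
  proof -
    have "filtermap (times (1 / r)) (at_right 0) = at_right ((1 / r) * 0)"
      using r by (intro filtermap_times_pos_at_right) simp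
    then have eq: "filtermap (times (1 / r)) (at_right 0) = at_right 0" by simp
    show ?thesis
      by (subst (2) eq[symmetric]) (simp add: filterlim_filtermap)
  qed
  have gen: "(f, h) \<in> divide_graph A r \<longleftrightarrow> f \<in> L2 \<mu> \<and> h \<in> L2 \<mu> \<and>
      ((\<lambda>t. l2_norm ?\<nu> (\<lambda>x. (P (t / r) f x - f x) / t - h x)) \<longlongrightarrow> 0) (at_right 0)" for f h
  proof -
    have "l2_norm \<mu> (\<lambda>x. (P (t / r) f x - f x) / t - h x) =
        (1 / r) * l2_norm \<mu> (\<lambda>x. (P (t / r) f x - f x) / (t / r) - r * h x)" for t
    proof -
      have "(\<lambda>x. (P (t / r) f x - f x) / t - h x) =
          (\<lambda>x. (1 / r) * ((P (t / r) f x - f x) / (t / r) - r * h x))"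
        \<comment> \<open>Division by zero yields 0 on both sides, so the identity holds for every
          \<open>t\<close>, and the two limits concern equal functions.\<close>
        using r by (cases "t = 0") (auto simp: fun_eq_iff field_simps)
      then show ?thesis
        using r l2_norm_cmult[of \<mu> "1 / r"] by (simp only:) simp
    qed
    then have "((\<lambda>t. l2_norm \<mu> (\<lambda>x. (P (t / r) f x - f x) / t - h x)) \<longlongrightarrow> 0) (at_right 0) \<longleftrightarrow>
        ((\<lambda>t. (1 / r) * l2_norm \<mu> (\<lambda>x. (P (t / r) f x - f x) / (t / r) - r * h x)) \<longlongrightarrow> 0) (at_right 0)"
      by presburger
    also have "\<dots> \<longleftrightarrow> ((\<lambda>t. l2_norm \<mu> (\<lambda>x. (P (t / r) f x - f x) / (t / r) - r * h x)) \<longlongrightarrow> 0) (at_right 0)"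
      using r by (intro tendsto_mult_left_0_iff) simp
    also have "\<dots> \<longleftrightarrow> ((\<lambda>t. l2_norm \<mu> (\<lambda>x. (P t f x - f x) / t - r * h x)) \<longlongrightarrow> 0) (at_right 0)"
      by (rule lim)
    finally have "((\<lambda>t. l2_norm ?\<nu> (\<lambda>x. (P (t / r) f x - f x) / t - h x)) \<longlongrightarrow> 0) (at_right 0) \<longleftrightarrow>
        ((\<lambda>t. l2_norm \<mu> (\<lambda>x. (P t f x - f x) / t - r * h x)) \<longlongrightarrow> 0) (at_right 0)"
      unfolding l2_norm_density_const_tendsto[OF \<kappa>] .
    moreover have "(\<lambda>x. r * h x) \<in> L2 \<mu> \<longleftrightarrow> h \<in> L2 \<mu>"
      using r by (intro L2_cmult_iff) simp
    ultimately show ?thesis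
      unfolding divide_graph_iff generator_iff[OF P] by blast
  qed
  have "self_adjoint_op ?\<nu> (divide_graph A r)"
    unfolding self_adjoint_op_density_const[OF \<kappa>]
    using conjunct1[OF P[unfolded heat_semigroup_def]] r
    by (intro self_adjoint_op_divide_graph) simp_all
  moreover have "\<forall>t\<ge>0. \<forall>f\<in>L2 ?\<nu>. P (t / r) f \<in> L2 ?\<nu> \<and> l2_norm ?\<nu> (P (t / r) f) \<le> l2_norm ?\<nu> f"
    using r \<kappa> by (auto simp: L2_density_const l2_norm_density_const
        intro!: mult_left_mono semigroup_L2[OF P] semigroup_norm_le[OF P])
  moreover have "\<forall>t\<ge>0. \<forall>f\<in>L2 ?\<nu>. \<forall>h\<in>L2 ?\<nu>. \<forall>a b.
      AE x in ?\<nu>. P (t / r) (\<lambda>y. a * f y + b * h y) x = a * P (t / r) f x + b * P (t / r) h x"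
    unfolding L2_density_const[OF \<kappa>] AE_density_const[OF \<kappa>]
    using r by (intro allI impI ballI semigroup_linear[OF P]) auto
  moreover have "\<forall>f\<in>L2 ?\<nu>. AE x in ?\<nu>. P (0 / r) f x = f x"
    unfolding L2_density_const[OF \<kappa>] AE_density_const[OF \<kappa>]
    using P by (simp add: heat_semigroup_def)
  moreover have "\<forall>s\<ge>0. \<forall>t\<ge>0. \<forall>f\<in>L2 ?\<nu>. AE x in ?\<nu>. P ((s + t) / r) f x = P (s / r) (P (t / r) f) x"
    unfolding L2_density_const[OF \<kappa>] AE_density_const[OF \<kappa>] add_divide_distrib
    using P r by (simp add: heat_semigroup_def)
  moreover have "\<forall>f\<in>L2 ?\<nu>. ((\<lambda>t. l2_norm ?\<nu> (\<lambda>x. P (t / r) f x - f x)) \<longlongrightarrow> 0) (at_right 0)"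
    unfolding L2_density_const[OF \<kappa>] l2_norm_density_const_tendsto[OF \<kappa>]
  proof
    fix f assume "f \<in> L2 \<mu>"
    then show "((\<lambda>t. l2_norm \<mu> (\<lambda>x. P (t / r) f x - f x)) \<longlongrightarrow> 0) (at_right 0)"
      using semigroup_continuous[OF P] lim[of "\<lambda>t. l2_norm \<mu> (\<lambda>x. P t f x - f x)"]
      by (simp add: l2_dist_def)
  qed
  moreover have "divide_graph A r = {(f, h). f \<in> L2 ?\<nu> \<and> h \<in> L2 ?\<nu> \<and>
      ((\<lambda>t. l2_norm ?\<nu> (\<lambda>x. (P (t / r) f x - f x) / t - h x)) \<longlongrightarrow> 0) (at_right 0)}"
    unfolding L2_density_const[OF \<kappa>] using gen by blast
  ultimately show ?thesis unfolding heat_semigroup_def by blast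
qed

lemma integral_kernel_density_const:
  assumes "integral_kernel \<mu> h T" "\<kappa> > 0"
  shows "integral_kernel (density \<mu> (\<lambda>_. ennreal \<kappa>)) (\<lambda>x y. h x y / \<kappa>) T"
  unfolding integral_kernel_def L2_density_const[OF assms(2)] AE_density_const[OF assms(2)]
    integrable_density_const[OF assms(2)] integral_density_const[OF assms(2)]
proof
  fix f assume "f \<in> L2 \<mu>"
  then have "AE x in \<mu>. integrable \<mu> (\<lambda>y. h x y * f y) \<and> T f x = (\<integral>y. h x y * f y \<partial>\<mu>)"
    using assms(1) by (simp add: integral_kernel_def)
  then show "AE x in \<mu>. integrable \<mu> (\<lambda>y. h x y / \<kappa> * f y) \<and> T f x = \<kappa> * (\<integral>y. h x y / \<kappa> * f y \<partial>\<mu>)"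
    by (rule eventually_mono) (use assms(2) in simp)
qed

lemma smooth_kernel_divide:
  assumes \<A>: "smooth_atlas \<A>" and M: "open M" and h: "smooth_kernel \<A> M h"
  shows "smooth_kernel \<A> M (\<lambda>x y. h x y / \<kappa>)"
  unfolding smooth_kernel_def
proof (intro ballI)
  fix k l assume kl: "k \<in> \<A>" "l \<in> \<A>"
  have op: "open (chart_map k ` (chart_dom k \<inter> M) \<times> chart_map l ` (chart_dom l \<inter> M))"
    using M smooth_atlasD(1)[OF \<A>] kl by (intro open_Times open_chart_image[OF \<A>] open_Int) auto
  show "smooth_on (chart_map k ` (chart_dom k \<inter> M) \<times> chart_map l ` (chart_dom l \<inter> M))
      (\<lambda>(u, v). h (chart_inv k u) (chart_inv l v) / \<kappa>)"
  proof (rule smooth_on_cmult[OF op])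
    show "smooth_on (chart_map k ` (chart_dom k \<inter> M) \<times> chart_map l ` (chart_dom l \<inter> M))
        (\<lambda>(u, v). h (chart_inv k u) (chart_inv l v))"
      using h kl unfolding smooth_kernel_def by blast
    show "(\<lambda>(u, v). h (chart_inv k u) (chart_inv l v) / \<kappa>) z =
        (1 / \<kappa>) *\<^sub>R (\<lambda>(u, v). h (chart_inv k u) (chart_inv l v)) z" for z
      by (simp add: case_prod_beta)
  qed
qed

text \<open>The energy is multiplied by \<open>\<kappa> / r\<close> and the norm by a constant, so
  the same sequences of test functions are Cauchy and have the same limits.\<close>

lemma sobolev_H01_scale:
  assumes \<A>: "smooth_atlas \<A>" and g: "riemannian_metric \<A> g" and r: "r > 0" and \<kappa>: "\<kappa> > 0"
  shows "sobolev_H01 \<A> (scale_metric r g) (density \<mu> (\<lambda>_. ennreal \<kappa>)) M = sobolev_H01 \<A> g \<mu> M"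
proof -
  have "(\<integral>x. grad_norm_sq \<A> (scale_metric r g) f x \<partial>density \<mu> (\<lambda>_. ennreal \<kappa>)) =
      (\<kappa> / r) * (\<integral>x. grad_norm_sq \<A> g f x \<partial>\<mu>)" for f
    using r by (simp add: integral_density_const[OF \<kappa>] grad_norm_sq_scale_metric[OF \<A> g])
  moreover have "(\<forall>e>0. \<exists>N. \<forall>m\<ge>N. \<forall>n\<ge>N. (\<kappa> / r) * X m n < e) \<longleftrightarrow>
      (\<forall>e>0. \<exists>N. \<forall>m\<ge>N. \<forall>n\<ge>N. X m n < e)" (is "?l \<longleftrightarrow> ?r") for X :: "nat \<Rightarrow> nat \<Rightarrow> real"
  proof
    have eq: "(\<kappa> / r) * a < (\<kappa> / r) * e \<longleftrightarrow> a < e" for a e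
      using r \<kappa> by (simp add: divide_less_cancel)
    {
      assume L: ?l
      show ?r
      proof (intro allI impI)
        fix e :: real assume "e > 0"
        then show "\<exists>N. \<forall>m\<ge>N. \<forall>n\<ge>N. X m n < e"
          using L[rule_format, of "(\<kappa> / r) * e"] r \<kappa> by (simp only: eq) simp
      qed
    next
      assume R: ?r
      show ?l
      proof (intro allI impI)
        fix e :: real assume "e > 0"
        then have "\<exists>N. \<forall>m\<ge>N. \<forall>n\<ge>N. X m n < e / (\<kappa> / r)"
          using R[rule_format, of "e / (\<kappa> / r)"] r \<kappa> by simp
        moreover have "(\<kappa> / r) * (e / (\<kappa> / r)) = e" using r \<kappa> by simp
        ultimately show "\<exists>N. \<forall>m\<ge>N. \<forall>n\<ge>N. (\<kappa> / r) * X m n < e"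
          using eq by metis
      qed
    }
  qed
  ultimately show ?thesis
    by (simp only: sobolev_H01_def L2_density_const[OF \<kappa>] l2_norm_density_const_tendsto[OF \<kappa>])
qed

text \<open>For the whole manifold, uniqueness of the extension has to be transported together with
  its existence. For a domain, only the distributional equation changes.\<close>

lemma laplacian_scale:
  assumes \<A>: "smooth_atlas \<A>" and g: "riemannian_metric \<A> g" and r: "r > 0" and \<kappa>: "\<kappa> > 0"
    and A: "laplacian \<A> g \<mu> M A"
  shows "laplacian \<A> (scale_metric r g) (density \<mu> (\<lambda>_. ennreal \<kappa>)) M (divide_graph A r)"
proof (cases "M = UNIV")
  case True
  let ?\<nu> = "density \<mu> (\<lambda>_. ennreal \<kappa>)"
  have "{B. self_adjoint_op \<mu> B \<and> minimal_laplacian \<A> g M \<subseteq> B} = {A}"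
    using A True unfolding laplacian_def by simp
  then have uniq: "self_adjoint_op \<mu> B \<and> minimal_laplacian \<A> g M \<subseteq> B \<longleftrightarrow> B = A" for B
    by blast
  \<comment> \<open>Division by \<open>r\<close> and by \<open>1 / r\<close> are mutually inverse.
    With \<open>sa\<close> and \<open>min\<close> they match the self-adjoint extensions for the two
    metrics, so one set is a singleton because the other is.\<close>
  have inv: "divide_graph (divide_graph B (1 / r)) r = B" "divide_graph (divide_graph B r) (1 / r) = B" for B :: "'a operator_graph"
    using r by (auto intro!: divide_graph_inverse)
  have sa: "self_adjoint_op ?\<nu> B \<longleftrightarrow> self_adjoint_op \<mu> (divide_graph B (1 / r))" for B
    using self_adjoint_op_divide_graph[of \<mu> B "1 / r"] r
      self_adjoint_op_divide_graph[of \<mu> "divide_graph B (1 / r)" r]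
    by (auto simp: self_adjoint_op_density_const[OF \<kappa>] inv)
  have min: "minimal_laplacian \<A> (scale_metric r g) M \<subseteq> B \<longleftrightarrow>
      minimal_laplacian \<A> g M \<subseteq> divide_graph B (1 / r)" for B
  proof -
    have "laplace_beltrami \<A> (scale_metric r g) f = (\<lambda>x. (1 / r) * laplace_beltrami \<A> g f x)"
      if "f \<in> test_functions \<A> M" for f
      using laplace_beltrami_scale_metric[OF \<A> g r that] by (auto simp: fun_eq_iff)
    then show ?thesis
      by (auto simp: minimal_laplacian_def subset_iff divide_graph_iff)
  qed
  have "self_adjoint_op ?\<nu> B \<and> minimal_laplacian \<A> (scale_metric r g) M \<subseteq> B \<longleftrightarrow> B = divide_graph A r" for B
    unfolding sa min uniq using inv by metis
  then show ?thesis
    using True unfolding laplacian_def by auto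
next
  case False
  let ?\<nu> = "density \<mu> (\<lambda>_. ennreal \<kappa>)"
  have AD: "A = dirichlet_laplacian \<A> g \<mu> M" using A False by (simp add: laplacian_def)
  \<comment> \<open>\<open>\<kappa>\<close> cancels, and the factor 1 / r in the Laplacian of the
    test function becomes the factor \<open>r\<close> on \<open>f\<close>.\<close>
  have "l2_inner ?\<nu> f \<phi> = l2_inner ?\<nu> u (laplace_beltrami \<A> (scale_metric r g) \<phi>) \<longleftrightarrow>
      l2_inner \<mu> (\<lambda>x. r * f x) \<phi> = l2_inner \<mu> u (laplace_beltrami \<A> g \<phi>)"
    if "\<phi> \<in> test_functions \<A> M" for f u \<phi>
  proof -
    have "l2_inner \<mu> u (laplace_beltrami \<A> g \<phi>) = r * l2_inner \<mu> u (laplace_beltrami \<A> (scale_metric r g) \<phi>)"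
      using r by (simp add: l2_inner_def laplace_beltrami_scale_metric[OF \<A> g r that])
    moreover have "l2_inner \<mu> (\<lambda>x. r * f x) \<phi> = r * l2_inner \<mu> f \<phi>"
      by (simp add: l2_inner_def mult.assoc)
    ultimately show ?thesis
      using r \<kappa> by (simp add: l2_inner_density_const)
  qed
  then have "divide_graph A r = dirichlet_laplacian \<A> (scale_metric r g) ?\<nu> M"
    unfolding AD using r
    by (auto simp: divide_graph_def dirichlet_laplacian_def sobolev_H01_scale[OF \<A> g r \<kappa>]
        L2_density_const[OF \<kappa>] L2_cmult_iff)
  then show ?thesis using False by (simp add: laplacian_def)
qed

lemma heat_kernel_scale:
  fixes \<A> :: "('a::{t2_space,second_countable_topology}, 'd::finite) chart set"
  assumes \<A>: "smooth_atlas \<A>" and g: "riemannian_metric \<A> g" and M: "open M" and r: "r > 0"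
    and H: "heat_kernel \<A> g M H"
  shows "heat_kernel \<A> (scale_metric r g) M (\<lambda>t x y. H (t / r) x y / sqrt (r ^ CARD('d)))"
proof -
  let ?\<kappa> = "sqrt (r ^ CARD('d))"
  have \<kappa>: "?\<kappa> > 0" using r by simp
  obtain V A P where V: "riemannian_measure \<A> g V" and A: "laplacian \<A> g (restrict_space V M) M A"
    and P: "heat_semigroup (restrict_space V M) A P"
    and ker: "\<And>t. t > 0 \<Longrightarrow> smooth_kernel \<A> M (H t)"
      "\<And>t. t > 0 \<Longrightarrow> integral_kernel (restrict_space V M) (H t) (P t)"
    using H unfolding heat_kernel_def by blast
  let ?V = "density V (\<lambda>_. ennreal ?\<kappa>)"
  have sV: "sets V = sets borel" using V by (simp add: riemannian_measure_def)
  then have eq: "restrict_space ?V M = density (restrict_space V M) (\<lambda>_. ennreal ?\<kappa>)"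
    using M sets_eq_imp_space_eq[OF sV] by (intro restrict_space_density_const) simp
  show ?thesis
    unfolding heat_kernel_def
  proof (intro exI conjI allI impI)
    show "riemannian_measure \<A> (scale_metric r g) ?V"
      by (rule riemannian_measure_scale_metric[OF \<A> g r V])
    show "laplacian \<A> (scale_metric r g) (restrict_space ?V M) M (divide_graph A r)"
      unfolding eq by (rule laplacian_scale[OF \<A> g r \<kappa> A])
    show "heat_semigroup (restrict_space ?V M) (divide_graph A r) (\<lambda>t. P (t / r))"
      unfolding eq by (rule heat_semigroup_scale[OF P \<kappa> r])
    fix t :: real assume "t > 0"
    then have "t / r > 0" using r by simp
    then show "smooth_kernel \<A> M (\<lambda>x y. H (t / r) x y / ?\<kappa>)"
      "integral_kernel (restrict_space ?V M) (\<lambda>x y. H (t / r) x y / ?\<kappa>) (P (t / r))"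
      unfolding eq using ker \<kappa> by (auto intro!: smooth_kernel_divide[OF \<A> M] integral_kernel_density_const)
  qed
qed

section \<open>Riesz fields\<close>

text \<open>The substitution preserves the half-line, and \<open>eq\<close> is assumed only there
  because a heat kernel is arbitrary at nonpositive times. The first claim needs no integrability,
  as the change of variables respects the default value of the integral.\<close>

lemma set_lebesgue_integral_scale:
  fixes f h :: "real \<Rightarrow> real"
  assumes r: "r > 0" and eq: "\<And>t. t > 0 \<Longrightarrow> h (r * t) = c * f t"
  shows "(LBINT t:{0<..}. h t) = r * c * (LBINT t:{0<..}. f t)"
    and "set_integrable lborel {0<..} f \<Longrightarrow> set_integrable lborel {0<..} h"
proof -
  have ind: "indicator {0<..} (r * t) *\<^sub>R h (r * t) = c * (indicator {0<..} t *\<^sub>R f t)" for t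
    using r eq by (auto simp: indicator_def zero_less_mult_iff)
  show "(LBINT t:{0<..}. h t) = r * c * (LBINT t:{0<..}. f t)"
    unfolding set_lebesgue_integral_def
    using r by (subst lborel_integral_real_affine[where c = r and t = 0]) (simp_all only: add_0 ind, simp)
  assume "set_integrable lborel {0<..} f"
  then have "integrable lborel (\<lambda>t. c * (indicator {0<..} t *\<^sub>R f t))"
    unfolding set_integrable_def by (rule integrable_mult_right)
  then have "integrable lborel (\<lambda>t. (\<lambda>t. indicator {0<..} t *\<^sub>R h t) (0 + r * t))"
    by (simp only: add_0 ind)
  then show "set_integrable lborel {0<..} h"
    unfolding set_integrable_def
    by (rule lborel_integrable_real_affine_iff[THEN iffD1, rotated]) (use r in simp)
qed

text \<open>The exponent balance \<open>2 + 2 (d / 2 + \<alpha> - 1) - d = 2 \<alpha>\<close> of the substitution \<open>t = c\<^sup>2 s\<close>.\<close>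
lemma riesz_scaling_exponent:
  fixes c :: real
  assumes "c > 0"
  shows "c\<^sup>2 * ((c\<^sup>2) powr (real d / 2 + \<alpha> - 1) / sqrt ((c\<^sup>2) ^ d)) = c powr \<alpha> * c powr \<alpha>"
proof -
  have "sqrt ((c\<^sup>2) ^ d) = c powr real d"
    using assms by (simp add: real_sqrt_power powr_realpow)
  moreover have "c\<^sup>2 = c powr 2"
    using assms by (simp add: powr_numeral)
  ultimately have "c\<^sup>2 * ((c\<^sup>2) powr (real d / 2 + \<alpha> - 1) / sqrt ((c\<^sup>2) ^ d)) =
      c powr (2 + (2 * (real d / 2 + \<alpha> - 1) - real d))"
    by (simp only: powr_powr powr_diff[of c "2 * _" "real d"] powr_add[of c 2 "_ - real d"])
  also have "2 + (2 * (real d / 2 + \<alpha> - 1) - real d) = \<alpha> + \<alpha>" by simp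
  finally show ?thesis by (simp only: powr_add)
qed

text \<open>Joint normality quantifies over all coefficients, which absorb the factor
  \<open>b\<close>.\<close>

lemma centered_gaussian_field_cmult:
  assumes "centered_gaussian_field \<Omega> I X"
  shows "centered_gaussian_field \<Omega> I (\<lambda>i \<omega>. b * X i \<omega>)"
proof -
  have "jointly_normal \<Omega> F (\<lambda>i \<omega>. b * X i \<omega>)" if "jointly_normal \<Omega> F X" for F
    using that[unfolded jointly_normal_def, rule_format, of "\<lambda>i. _ i * b"]
    by (simp add: jointly_normal_def mult.assoc)
  with assms show ?thesis
    by (auto simp: centered_gaussian_field_def gaussian_field_def)
qed

text \<open>Both Riesz fields are covered: \<open>q t x y\<close> is the combination of heat kernel values that
  defines the covariance.\<close>
lemma equal_in_distribution_scaled_field: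
  fixes q q' :: "real \<Rightarrow> 'a \<Rightarrow> 'a \<Rightarrow> real"
  assumes c: "c > 0"
    and X: "centered_gaussian_field \<Omega> M X" and Y: "centered_gaussian_field \<Omega>' M Y"
    and covX: "\<And>x y. x \<in> M \<Longrightarrow> y \<in> M \<Longrightarrow> prob_space.expectation \<Omega> (\<lambda>\<omega>. X x \<omega> * X y \<omega>) =
        1 / G * (LBINT t:{0<..}. t powr (real d / 2 + \<alpha> - 1) * q t x y)"
    and covY: "\<And>x y. x \<in> M \<Longrightarrow> y \<in> M \<Longrightarrow> prob_space.expectation \<Omega>' (\<lambda>\<omega>. Y x \<omega> * Y y \<omega>) =
        1 / G * (LBINT t:{0<..}. t powr (real d / 2 + \<alpha> - 1) * q' t x y)"
    and q': "\<And>t x y. t > 0 \<Longrightarrow> x \<in> M \<Longrightarrow> y \<in> M \<Longrightarrow> q' (c\<^sup>2 * t) x y = q t x y / sqrt ((c\<^sup>2) ^ d)"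
  shows "equal_in_distribution M \<Omega> (\<lambda>x \<omega>. c powr \<alpha> * X x \<omega>) \<Omega>' Y"
  unfolding equal_in_distribution_def
proof (intro conjI ballI)
  show "centered_gaussian_field \<Omega> M (\<lambda>x \<omega>. c powr \<alpha> * X x \<omega>)"
    by (rule centered_gaussian_field_cmult[OF X])
  show "centered_gaussian_field \<Omega>' M Y" by (rule Y)
  fix x y assume xy: "x \<in> M" "y \<in> M"
  let ?e = "real d / 2 + \<alpha> - 1"
  \<comment> \<open>The factor \<open>c\<^sup>2\<close> in front is the Jacobian, the power comes
    from the weight in the integrand, and the square root from the heat kernel.\<close>
  have "(LBINT t:{0<..}. t powr ?e * q' t x y) =
      c\<^sup>2 * ((c\<^sup>2) powr ?e / sqrt ((c\<^sup>2) ^ d)) * (LBINT t:{0<..}. t powr ?e * q t x y)"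
    using c q' xy by (intro set_lebesgue_integral_scale(1)) (simp_all add: powr_mult)
  also have "\<dots> = c powr \<alpha> * c powr \<alpha> * (LBINT t:{0<..}. t powr ?e * q t x y)"
    by (simp only: riesz_scaling_exponent[OF c])
  finally have "prob_space.expectation \<Omega>' (\<lambda>\<omega>. Y x \<omega> * Y y \<omega>) =
      c powr \<alpha> * c powr \<alpha> * prob_space.expectation \<Omega> (\<lambda>\<omega>. X x \<omega> * X y \<omega>)"
    using covX[OF xy] covY[OF xy] by simp
  also have "\<dots> = prob_space.expectation \<Omega> (\<lambda>\<omega>. (c powr \<alpha> * c powr \<alpha>) * (X x \<omega> * X y \<omega>))"
    by simp
  also have "(\<lambda>\<omega>. (c powr \<alpha> * c powr \<alpha>) * (X x \<omega> * X y \<omega>)) =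
      (\<lambda>\<omega>. c powr \<alpha> * X x \<omega> * (c powr \<alpha> * X y \<omega>))"
    by (simp add: mult_ac)
  finally show "prob_space.expectation \<Omega> (\<lambda>\<omega>. c powr \<alpha> * X x \<omega> * (c powr \<alpha> * X y \<omega>)) =
      prob_space.expectation \<Omega>' (\<lambda>\<omega>. Y x \<omega> * Y y \<omega>)" by simp
qed

lemma set_integrable_scaled_integrand:
  fixes c :: real
  assumes c: "c > 0"
    and q': "\<And>t. t > 0 \<Longrightarrow> q' (c\<^sup>2 * t) = q t / sqrt ((c\<^sup>2) ^ d)"
    and int: "set_integrable lborel {0<..} (\<lambda>t. t powr e * q t)"
  shows "set_integrable lborel {0<..} (\<lambda>t. t powr e * q' t)"
proof (rule set_lebesgue_integral_scale(2)[OF _ _ int])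
  show "(c\<^sup>2 * t) powr e * q' (c\<^sup>2 * t) = (c\<^sup>2) powr e / sqrt ((c\<^sup>2) ^ d) * (t powr e * q t)"
    if "t > 0" for t
    using q'[OF that] c that by (simp add: powr_mult)
qed (use c in simp)

theorem proposition3p7:
  fixes \<A> :: "('a::{t2_space,second_countable_topology}, 'd::finite) chart set"
    and g :: "('a, 'd) metric_tensor"
    and M :: "'a set" and p :: 'a and \<alpha> c :: real
    and \<Omega> :: "'w1 measure" and R :: "'a \<Rightarrow> 'w1 \<Rightarrow> real"
    and \<Omega>' :: "'w2 measure" and R' :: "'a \<Rightarrow> 'w2 \<Rightarrow> real"
    and \<Omega>h :: "'w3 measure" and hR :: "'a \<Rightarrow> 'w3 \<Rightarrow> real"
    and \<Omega>h' :: "'w4 measure" and hR' :: "'a \<Rightarrow> 'w4 \<Rightarrow> real"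
  assumes "CARD('d) \<ge> 2"
    and "complete_riemannian_manifold \<A> g"
    and "M = UNIV \<or> regular_domain \<A> M"
    and "p \<in> M"
    and "0 < \<alpha>" "\<alpha> < 1"
    and "c > 0"
  shows "(riesz_field_exists \<A> g M p \<alpha> \<longrightarrow>
            riesz_field_exists \<A> (scale_metric (c\<^sup>2) g) M p \<alpha> \<and>
            (riesz_field \<A> g M p \<alpha> \<Omega> R \<and>
             riesz_field \<A> (scale_metric (c\<^sup>2) g) M p \<alpha> \<Omega>' R' \<longrightarrow>
               equal_in_distribution M \<Omega> (\<lambda>x \<omega>. c powr \<alpha> * R x \<omega>) \<Omega>' R')) \<and>
         (stationary_riesz_field_exists \<A> g M \<alpha> \<longrightarrow>
            stationary_riesz_field_exists \<A> (scale_metric (c\<^sup>2) g) M \<alpha> \<and>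
            (stationary_riesz_field \<A> g M \<alpha> \<Omega>h hR \<and>
             stationary_riesz_field \<A> (scale_metric (c\<^sup>2) g) M \<alpha> \<Omega>h' hR' \<longrightarrow>
               equal_in_distribution M \<Omega>h (\<lambda>x \<omega>. c powr \<alpha> * hR x \<omega>) \<Omega>h' hR'))"
proof -
  let ?g = "scale_metric (c\<^sup>2) g" and ?s = "sqrt ((c\<^sup>2) ^ CARD('d))"
  have \<A>: "smooth_atlas \<A>" and g: "riemannian_metric \<A> g"
    using assms(2) by (auto simp: complete_riemannian_manifold_def riemannian_manifold_def)
  have M: "open M" using assms(3) by (auto simp: regular_domain_def)
  have c: "c\<^sup>2 > 0" using assms(7) by simp
  define S where "S H = (\<lambda>t x y. H (t / c\<^sup>2) x y / ?s)" for H :: "real \<Rightarrow> 'a \<Rightarrow> 'a \<Rightarrow> real"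
  have scaled: "heat_kernel \<A> ?g M (S H)" if "heat_kernel \<A> g M H" for H
    unfolding S_def by (rule heat_kernel_scale[OF \<A> g M c that])
  have S: "S H (c\<^sup>2 * t) x y = H t x y / ?s" for H t x y
    using assms(7) by (simp add: S_def)
  \<comment> \<open>The kernel \<open>H'\<close> that comes with the second field is arbitrary;
    uniqueness for the rescaled metric identifies it with \<open>S H\<close> for positive times and
    points of \<open>M\<close>.\<close>
  have kernel: "H' (c\<^sup>2 * t) x y = H t x y / ?s"
    if "heat_kernel \<A> g M H" "heat_kernel \<A> ?g M H'" "t > 0" "x \<in> M" "y \<in> M" for H H' t x y
    using heat_kernel_unique[OF \<A> scale_metric_riemannian[OF \<A> g c] M that(2) scaled[OF that(1)], of "c\<^sup>2 * t"]
      that c by (simp add: S)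
  show ?thesis
  proof (intro conjI impI)
    assume "riesz_field_exists \<A> g M p \<alpha>"
    then obtain H where H: "heat_kernel \<A> g M H"
      and int: "\<And>x y. x \<in> M \<Longrightarrow> y \<in> M \<Longrightarrow>
        set_integrable lborel {0<..} (riesz_integrand CARD('d) \<alpha> p H x y)"
      unfolding riesz_field_exists_def by blast
    \<comment> \<open>\<open>S H\<close> witnesses existence: all four kernel values in the
      integrand are divided by the same constant.\<close>
    have "set_integrable lborel {0<..} (riesz_integrand CARD('d) \<alpha> p (S H) x y)"
      if "x \<in> M" "y \<in> M" for x y
      using int[OF that] unfolding riesz_integrand_def[abs_def]
      by (rule set_integrable_scaled_integrand[where d = "CARD('d)", OF assms(7), rotated])
        (simp add: S diff_divide_distrib add_divide_distrib)
    with scaled[OF H] show "riesz_field_exists \<A> ?g M p \<alpha>"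
      unfolding riesz_field_exists_def by blast
  next
    assume "stationary_riesz_field_exists \<A> g M \<alpha>"
    then obtain H where H: "heat_kernel \<A> g M H"
      and int: "\<And>x y. x \<in> M \<Longrightarrow> y \<in> M \<Longrightarrow>
        set_integrable lborel {0<..} (stationary_riesz_integrand CARD('d) \<alpha> H x y)"
      unfolding stationary_riesz_field_exists_def by blast
    have "set_integrable lborel {0<..} (stationary_riesz_integrand CARD('d) \<alpha> (S H) x y)"
      if "x \<in> M" "y \<in> M" for x y
      using int[OF that] unfolding stationary_riesz_integrand_def[abs_def]
      by (rule set_integrable_scaled_integrand[where d = "CARD('d)", OF assms(7), rotated]) (simp add: S)
    with scaled[OF H] show "stationary_riesz_field_exists \<A> ?g M \<alpha>"
      unfolding stationary_riesz_field_exists_def by blast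
  next
    assume "riesz_field \<A> g M p \<alpha> \<Omega> R \<and> riesz_field \<A> ?g M p \<alpha> \<Omega>' R'"
    then obtain H H' where H: "heat_kernel \<A> g M H" "heat_kernel \<A> ?g M H'"
      and R: "centered_gaussian_field \<Omega> M R" "centered_gaussian_field \<Omega>' M R'"
      and cov: "\<And>x y. x \<in> M \<Longrightarrow> y \<in> M \<Longrightarrow> prob_space.expectation \<Omega> (\<lambda>\<omega>. R x \<omega> * R y \<omega>) =
          1 / Gamma (real CARD('d) / 2 + \<alpha>) * (LBINT t:{0<..}. riesz_integrand CARD('d) \<alpha> p H x y t)"
        "\<And>x y. x \<in> M \<Longrightarrow> y \<in> M \<Longrightarrow> prob_space.expectation \<Omega>' (\<lambda>\<omega>. R' x \<omega> * R' y \<omega>) =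
          1 / Gamma (real CARD('d) / 2 + \<alpha>) * (LBINT t:{0<..}. riesz_integrand CARD('d) \<alpha> p H' x y t)"
      unfolding riesz_field_def by blast
    \<comment> \<open>The integrand also evaluates the kernels at the origin, where they are
      identified because \<open>p\<close> lies in \<open>M\<close>.\<close>
    show "equal_in_distribution M \<Omega> (\<lambda>x \<omega>. c powr \<alpha> * R x \<omega>) \<Omega>' R'"
      by (rule equal_in_distribution_scaled_field[OF assms(7) R cov[unfolded riesz_integrand_def]])
        (simp_all add: kernel[OF H] assms(4) diff_divide_distrib add_divide_distrib)
  next
    assume "stationary_riesz_field \<A> g M \<alpha> \<Omega>h hR \<and> stationary_riesz_field \<A> ?g M \<alpha> \<Omega>h' hR'"
    then obtain H H' where H: "heat_kernel \<A> g M H" "heat_kernel \<A> ?g M H'"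
      and R: "centered_gaussian_field \<Omega>h M hR" "centered_gaussian_field \<Omega>h' M hR'"
      and cov: "\<And>x y. x \<in> M \<Longrightarrow> y \<in> M \<Longrightarrow> prob_space.expectation \<Omega>h (\<lambda>\<omega>. hR x \<omega> * hR y \<omega>) =
          1 / Gamma (real CARD('d) / 2 + \<alpha>) * (LBINT t:{0<..}. stationary_riesz_integrand CARD('d) \<alpha> H x y t)"
        "\<And>x y. x \<in> M \<Longrightarrow> y \<in> M \<Longrightarrow> prob_space.expectation \<Omega>h' (\<lambda>\<omega>. hR' x \<omega> * hR' y \<omega>) =
          1 / Gamma (real CARD('d) / 2 + \<alpha>) * (LBINT t:{0<..}. stationary_riesz_integrand CARD('d) \<alpha> H' x y t)"
      unfolding stationary_riesz_field_def by blast
    show "equal_in_distribution M \<Omega>h (\<lambda>x \<omega>. c powr \<alpha> * hR x \<omega>) \<Omega>h' hR'"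
      by (rule equal_in_distribution_scaled_field[OF assms(7) R cov[unfolded stationary_riesz_integrand_def]])
        (simp_all add: kernel[OF H])
  qed
qed

end
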